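(* The following families of $\Pi^0_1$ classes have no effective numbering: (1) $\Pi^0_1$ classes containing only Martin-Löf random reals; (2) special $\Pi^0_1$ classes (those containing only non-computable reals); (3) $\Pi^0_1$ classes containing only reals $x$ such that the Muchnik degree of $\{x\}$ is above a fixed nonzero Muchnik degree; (4) $\Pi^0_1$ classes containing only finite (or only co-finite) subsets of $\omega$.
   Context: Reals are elements of $2^\omega$, identified with subsets of $\omega$ via characteristic functions. A tree is a set $T\subseteq 2^{<\omega}$ closed under prefixes, and $[T]=\{X\in 2^\omega : \forall n\; X\upharpoonright n\in T\}$, where $X\upharpoonright n$ is the initial segment of $X$ of length $n$. A $\Pi^0_1$ class is a set of the form $[T]$ for a computable tree $T\subseteq 2^{<\omega}$. A family $\mathcal{C}$ of closed subsets of $2^\omega$ has an effective numbering (effective enumeration) if there is a $\Pi^0_1$ set $S\subseteq 2^\omega\times\omega$ such that $\mathcal{C}=\{\{X : (X,e)\in S\} : e\in\omega\}$; equivalently, if there is a uniformly computable sequence of trees $\{T_e\}_{e\in\omega}$ with $\mathcal{C}=\{[T_e] : e\in\omega\}$. $K$ denotes prefix-free Kolmogorov complexity; by Schnorr's Theorem, $x\in 2^\omega$ is Martin-Löf random if and only if there is a constant $c$ with $K(x\upharpoonright n)\ge n-c$ for all $n$. For $A,B\subseteq 2^\omega$, $A$ is Muchnik (weakly) reducible to $B$ if every member of $B$ Turing-computes some member of $A$; Muchnik degrees are the equivalence classes of the induced preorder, ordered by this reducibility; the zero degree is that of the sets having a computable member. "Above" means $\ge$ in this order.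
   Formalization: In (3) it is additionally assumed that some nonempty Π⁰₁ class has all its members above the fixed nonzero Muchnik degree; otherwise (e.g. for the degree of the empty set) the family consists only of the empty class, which has an effective numbering. *)

theory Defs
  imports "HOL-Probability.Probability"
begin

section \<open>Oracle computability\<close>

type_synonym cantor = "nat \<Rightarrow> bool"

text \<open>
  Kleene's partial recursive functions relative to an oracle. The inductive relation
  \<open>evals A p xs y\<close> says that program \<open>p\<close> with oracle \<open>A\<close> halts on the arguments \<open>xs\<close> with
  output \<open>y\<close>; divergence is the absence of any such \<open>y\<close>. Ill-formed arities simply diverge.
\<close>

datatype recf =
    Zero
  | Succ
  | Proj nat
  | Oracle
  | Comp recf "recf list"
  | PrimRec recf recf
  | Mu recf

inductive evals :: "cantor \<Rightarrow> recf \<Rightarrow> nat list \<Rightarrow> nat \<Rightarrow> bool" for A :: cantor where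
  evals_Zero: "evals A Zero xs 0"
| evals_Succ: "evals A Succ [x] (Suc x)"
| evals_Proj: "i < length xs \<Longrightarrow> evals A (Proj i) xs (xs ! i)"
| evals_Oracle: "evals A Oracle [x] (of_bool (A x))"
| evals_Comp: "\<lbrakk>length ys = length gs; \<And>i. i < length gs \<Longrightarrow> evals A (gs ! i) xs (ys ! i);
    evals A f ys y\<rbrakk> \<Longrightarrow> evals A (Comp f gs) xs y"
| evals_PrimRec_0: "evals A f xs y \<Longrightarrow> evals A (PrimRec f g) (0 # xs) y"
| evals_PrimRec_Suc: "\<lbrakk>evals A (PrimRec f g) (n # xs) z; evals A g (n # z # xs) y\<rbrakk>
    \<Longrightarrow> evals A (PrimRec f g) (Suc n # xs) y"
| evals_Mu: "\<lbrakk>evals A f (n # xs) 0; \<And>m. m < n \<Longrightarrow> \<exists>k. evals A f (m # xs) (Suc k)\<rbrakk>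
    \<Longrightarrow> evals A (Mu f) xs n"

inductive_cases evals_ZeroE: "evals A Zero xs y"
inductive_cases evals_SuccE: "evals A Succ xs y"
inductive_cases evals_ProjE: "evals A (Proj i) xs y"
inductive_cases evals_OracleE: "evals A Oracle xs y"
inductive_cases evals_CompE: "evals A (Comp f gs) xs y"
inductive_cases evals_PrimRec_0E: "evals A (PrimRec f g) (0 # xs) y"
inductive_cases evals_PrimRec_SucE: "evals A (PrimRec f g) (Suc n # xs) y"
inductive_cases evals_MuE: "evals A (Mu f) xs y"

lemma evals_deterministic: "evals A p xs y \<Longrightarrow> evals A p xs z \<Longrightarrow> y = z"
proof (induction arbitrary: z rule: evals.induct)
  case (evals_Zero xs)
  then show ?case by (rule evals_ZeroE) simp
next
  case (evals_Succ x)
  then show ?case by (rule evals_SuccE) simp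
next
  case (evals_Proj i xs)
  from evals_Proj(2) show ?case by (rule evals_ProjE) simp
next
  case (evals_Oracle x)
  then show ?case by (rule evals_OracleE) simp
next
  case (evals_Comp ys gs xs f y)
  from evals_Comp.prems obtain ys' where ys': "length ys' = length gs"
      "\<And>i. i < length gs \<Longrightarrow> evals A (gs ! i) xs (ys' ! i)" "evals A f ys' z"
    by (rule evals_CompE) blast
  have "ys = ys'"
  proof (rule nth_equalityI)
    show "length ys = length ys'" using ys'(1) evals_Comp.hyps(1) by simp
    show "ys ! i = ys' ! i" if "i < length ys" for i
      using that ys'(2) evals_Comp.hyps(1) evals_Comp.IH(1) by simp
  qed
  with ys'(3) evals_Comp.IH(2) show ?case by blast
next
  case (evals_PrimRec_0 f xs y g)
  from evals_PrimRec_0.prems have "evals A f xs z" by (rule evals_PrimRec_0E)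
  then show ?case by (rule evals_PrimRec_0.IH)
next
  case (evals_PrimRec_Suc f g n xs u y)
  from evals_PrimRec_Suc.prems obtain v where
    v: "evals A (PrimRec f g) (n # xs) v" "evals A g (n # v # xs) z"
    by (rule evals_PrimRec_SucE)
  have "u = v" using v(1) by (rule evals_PrimRec_Suc.IH(1))
  with v(2) have "evals A g (n # u # xs) z" by simp
  then show ?case by (rule evals_PrimRec_Suc.IH(2))
next
  case (evals_Mu f n xs)
  from evals_Mu.prems have z: "evals A f (z # xs) 0"
      "\<And>m. m < z \<Longrightarrow> \<exists>k. evals A f (m # xs) (Suc k)"
    by - (erule evals_MuE, blast)+
  show ?case
  proof (cases n z rule: linorder_cases)
    case less
    with z(2) obtain k where "evals A f (n # xs) (Suc k)" by blast
    then have "0 = Suc k" by (rule evals_Mu.IH(1))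
    then show ?thesis by simp
  next
    case greater
    with evals_Mu.IH(2) obtain k where "\<forall>y. evals A f (z # xs) y \<longrightarrow> Suc k = y" by blast
    with z(1) show ?thesis by blast
  qed
qed

abbreviation no_oracle :: cantor where
  "no_oracle \<equiv> (\<lambda>_. False)"

definition turing_le :: "cantor \<Rightarrow> cantor \<Rightarrow> bool" where
  "turing_le X Y \<longleftrightarrow> (\<exists>p. \<forall>n. evals Y p [n] (of_bool (X n)))"

definition computable_real :: "cantor \<Rightarrow> bool" where
  "computable_real X \<longleftrightarrow> (\<exists>p. \<forall>n. evals no_oracle p [n] (of_bool (X n)))"

text \<open>The standard computable bijection between binary strings and natural numbers.\<close>

fun str :: "bool list \<Rightarrow> nat" where
  "str [] = 0"
| "str (b # \<sigma>) = 2 * str \<sigma> + (if b then 2 else 1)"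

lemma bij_str: "bij str"
proof (rule bijI)
  have "str \<sigma> = str \<tau> \<Longrightarrow> \<sigma> = \<tau>" for \<sigma> \<tau>
  proof (induction \<sigma> arbitrary: \<tau>)
    case Nil
    then show ?case by (cases \<tau>) (auto split: if_splits)
  next
    case (Cons b \<sigma>)
    then obtain c \<rho> where \<tau>: "\<tau> = c # \<rho>"
      by (cases \<tau>) (auto split: if_splits)
    from Cons.prems have "b = c \<and> str \<sigma> = str \<rho>"
      unfolding \<tau> by (simp split: if_splits; presburger)
    with Cons.IH \<tau> show ?case by blast
  qed
  then show "inj str" by (rule injI)
  have "\<exists>\<sigma>. str \<sigma> = n" for n
  proof (induction n rule: less_induct)
    case (less n)
    show ?case
    proof (cases "n = 0")
      case True
      then show ?thesis by (intro exI[of _ "[]"]) simp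
    next
      case False
      then obtain \<sigma> where \<sigma>: "str \<sigma> = (n - 1) div 2"
        using less.IH[of "(n - 1) div 2"] by fastforce
      have "str (even n # \<sigma>) = n"
        using False unfolding str.simps \<sigma> by (auto; presburger)
      then show ?thesis ..
    qed
  qed
  then show "surj str" by (metis surjI)
qed

definition computable_str_set :: "bool list set \<Rightarrow> bool" where
  "computable_str_set D \<longleftrightarrow> (\<exists>p. \<forall>\<sigma>. evals no_oracle p [str \<sigma>] (of_bool (\<sigma> \<in> D)))"

definition computable_str_rel :: "(bool list \<times> nat) set \<Rightarrow> bool" where
  "computable_str_rel R \<longleftrightarrow>
     (\<exists>p. \<forall>\<sigma> e. evals no_oracle p [str \<sigma>, e] (of_bool ((\<sigma>, e) \<in> R)))"

definition uniformly_ce :: "(nat \<Rightarrow> bool list set) \<Rightarrow> bool" where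
  "uniformly_ce V \<longleftrightarrow>
     (\<exists>p. \<forall>n \<sigma>. \<sigma> \<in> V n \<longleftrightarrow> (\<exists>y. evals no_oracle p [n, str \<sigma>] y))"


section \<open>Effectively closed classes and effective numberings\<close>

definition initial_segment :: "cantor \<Rightarrow> nat \<Rightarrow> bool list" where
  "initial_segment X n = map X [0..<n]"

definition is_tree :: "bool list set \<Rightarrow> bool" where
  "is_tree T \<longleftrightarrow> (\<forall>\<sigma> \<tau>. \<sigma> @ \<tau> \<in> T \<longrightarrow> \<sigma> \<in> T)"

definition paths :: "bool list set \<Rightarrow> cantor set" where
  "paths T = {X. \<forall>n. initial_segment X n \<in> T}"

definition pi01_class :: "cantor set \<Rightarrow> bool" where
  "pi01_class P \<longleftrightarrow> (\<exists>T. is_tree T \<and> computable_str_set T \<and> P = paths T)"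

definition pi01_product :: "(cantor \<times> nat) set \<Rightarrow> bool" where
  "pi01_product S \<longleftrightarrow>
     (\<exists>R. computable_str_rel R \<and> S = {(X, e). \<forall>n. (initial_segment X n, e) \<in> R})"

definition has_effective_numbering :: "cantor set set \<Rightarrow> bool" where
  "has_effective_numbering \<C> \<longleftrightarrow>
     (\<exists>S. pi01_product S \<and> \<C> = {{X. (X, e) \<in> S} | e. e \<in> UNIV})"

definition pi01_classes_within :: "cantor set \<Rightarrow> cantor set set" where
  "pi01_classes_within Q = {P. pi01_class P \<and> P \<subseteq> Q}"


section \<open>Martin-Loef randomness\<close>

definition coin_measure :: "cantor measure" where
  "coin_measure = PiM UNIV (\<lambda>_. measure_pmf (bernoulli_pmf (1/2)))"

definition cylinder :: "bool list \<Rightarrow> cantor set" where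
  "cylinder \<sigma> = {X. initial_segment X (length \<sigma>) = \<sigma>}"

lemma cylinder_eq: "cylinder \<sigma> = {X. \<forall>i<length \<sigma>. X i = \<sigma> ! i}"
  unfolding cylinder_def initial_segment_def by (subst list_eq_iff_nth_eq) simp

lemma cylinder_measurable: "cylinder \<sigma> \<in> sets coin_measure"
proof -
  have "cylinder \<sigma> = {X \<in> space coin_measure. \<forall>i \<in> {..<length \<sigma>}. X i = \<sigma> ! i}"
    unfolding cylinder_eq by (auto simp: coin_measure_def space_PiM)
  also have "\<dots> \<in> sets coin_measure"
    unfolding coin_measure_def by measurable
  finally show ?thesis .
qed

lemma measure_cylinder: "measure coin_measure (cylinder \<sigma>) = (1/2) ^ length \<sigma>"
proof -
  let ?M = "\<lambda>_::nat. measure_pmf (bernoulli_pmf (1/2))"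
  let ?J = "{..<length \<sigma>}"
  interpret product_prob_space ?M UNIV
    by (intro product_prob_spaceI measure_pmf.prob_space_axioms)
  have "cylinder \<sigma> = prod_emb UNIV ?M ?J (\<Pi>\<^sub>E i\<in>?J. {\<sigma> ! i})"
    unfolding cylinder_eq by (rule set_eqI) (simp add: prod_emb_iff PiE_iff Ball_def)
  then have "measure coin_measure (cylinder \<sigma>) = (\<Prod>i\<in>?J. measure (?M i) {\<sigma> ! i})"
    unfolding coin_measure_def by (simp only:) (rule measure_PiM_emb; simp)
  also have "\<dots> = (\<Prod>i\<in>?J. 1/2)"
  proof (rule prod.cong)
    fix i
    show "measure (?M i) {\<sigma> ! i} = 1/2"
      by (cases "\<sigma> ! i") (simp_all add: measure_pmf_single)
  qed simp
  finally show ?thesis by simp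
qed

definition ml_test :: "(nat \<Rightarrow> bool list set) \<Rightarrow> bool" where
  "ml_test V \<longleftrightarrow> uniformly_ce V \<and>
     (\<forall>n. measure coin_measure (\<Union>\<sigma>\<in>V n. cylinder \<sigma>) \<le> (1/2) ^ n)"

definition ml_random :: "cantor \<Rightarrow> bool" where
  "ml_random X \<longleftrightarrow> (\<forall>V. ml_test V \<longrightarrow> X \<notin> (\<Inter>n. \<Union>\<sigma>\<in>V n. cylinder \<sigma>))"


section \<open>Muchnik degrees\<close>

definition muchnik_le :: "cantor set \<Rightarrow> cantor set \<Rightarrow> bool" where
  "muchnik_le A B \<longleftrightarrow> (\<forall>Y\<in>B. \<exists>X\<in>A. turing_le X Y)"

definition muchnik_equiv :: "(cantor set \<times> cantor set) set" where
  "muchnik_equiv = {(A, B). muchnik_le A B \<and> muchnik_le B A}"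

definition muchnik_degrees :: "cantor set set set" where
  "muchnik_degrees = UNIV // muchnik_equiv"

definition muchnik_degree :: "cantor set \<Rightarrow> cantor set set" where
  "muchnik_degree A = muchnik_equiv `` {A}"

definition degree_le :: "cantor set set \<Rightarrow> cantor set set \<Rightarrow> bool" where
  "degree_le d e \<longleftrightarrow> (\<exists>A\<in>d. \<exists>B\<in>e. muchnik_le A B)"

definition zero_degree :: "cantor set set" where
  "zero_degree = {A. \<exists>X\<in>A. computable_real X}"


text \<open>Well-definedness of the above: Turing reducibility is a preorder, so \<open>muchnik_equiv\<close> is an
  equivalence relation, \<open>degree_le\<close> does not depend on representatives, and \<open>zero_degree\<close> is
  a degree.\<close>

fun subst_oracle :: "recf \<Rightarrow> recf \<Rightarrow> recf" where
  "subst_oracle q Zero = Zero"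
| "subst_oracle q Succ = Succ"
| "subst_oracle q (Proj i) = Proj i"
| "subst_oracle q Oracle = q"
| "subst_oracle q (Comp f gs) = Comp (subst_oracle q f) (map (subst_oracle q) gs)"
| "subst_oracle q (PrimRec f g) = PrimRec (subst_oracle q f) (subst_oracle q g)"
| "subst_oracle q (Mu f) = Mu (subst_oracle q f)"

lemma evals_subst_oracle:
  assumes "evals A p xs y" and q: "\<And>n. evals B q [n] (of_bool (A n))"
  shows "evals B (subst_oracle q p) xs y"
  using assms(1)
proof (induction rule: evals.induct)
  case (evals_Comp ys gs xs f y)
  then show ?case by (auto intro!: evals.evals_Comp[where ys = ys])
next
  case (evals_Mu f n xs)
  then show ?case by (auto intro!: evals.evals_Mu)
next
  case (evals_Oracle x)
  show ?case using q by simp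
qed (auto intro: evals.intros)

lemma turing_le_refl: "turing_le X X"
  unfolding turing_le_def by (rule exI[of _ Oracle]) (simp add: evals_Oracle)

lemma turing_le_trans: "turing_le X Y \<Longrightarrow> turing_le Y Z \<Longrightarrow> turing_le X Z"
  unfolding turing_le_def by (meson evals_subst_oracle)

lemma computable_real_iff: "computable_real X \<longleftrightarrow> turing_le X no_oracle"
  by (simp add: computable_real_def turing_le_def)

lemma computable_turing_le:
  assumes "computable_real X" shows "turing_le X Y"
proof -
  have "turing_le no_oracle Y"
    unfolding turing_le_def by (rule exI[of _ Zero]) (simp add: evals_Zero)
  with assms show ?thesis by (auto simp: computable_real_iff intro: turing_le_trans)
qed

lemma muchnik_le_refl: "muchnik_le A A"
  using turing_le_refl by (auto simp: muchnik_le_def)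

lemma muchnik_le_trans: "muchnik_le A B \<Longrightarrow> muchnik_le B C \<Longrightarrow> muchnik_le A C"
  unfolding muchnik_le_def by (meson turing_le_trans)

lemma equiv_muchnik: "equiv UNIV muchnik_equiv"
  by (auto simp: equiv_def refl_on_def sym_def trans_def muchnik_equiv_def
      intro: muchnik_le_refl muchnik_le_trans)

lemma degree_le_muchnik_degree:
  "degree_le (muchnik_degree A) (muchnik_degree B) \<longleftrightarrow> muchnik_le A B"
  by (auto simp: degree_le_def muchnik_degree_def muchnik_equiv_def
      intro: muchnik_le_refl muchnik_le_trans)

lemma zero_degree_eq: "zero_degree = muchnik_degree UNIV"
  by (auto simp: zero_degree_def muchnik_degree_def muchnik_equiv_def muchnik_le_def
      computable_real_iff intro: turing_le_refl)
    (metis computable_real_iff computable_turing_le)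


text \<open>The family whose only member is the empty class does have an effective numbering. Every
  family of the form \<open>pi01_classes_within Q\<close> contains the empty class, so such a family
  can fail to have an effective numbering only if it also has a nonempty member.\<close>

lemma has_effective_numbering_empty_class: "has_effective_numbering {{}}"
proof -
  have "computable_str_rel {}"
    unfolding computable_str_rel_def by (rule exI[of _ Zero]) (simp add: evals_Zero)
  then have "pi01_product {}"
    unfolding pi01_product_def by (intro exI[of _ "{}"]) auto
  then show ?thesis
    unfolding has_effective_numbering_def by (intro exI[of _ "{}"]) auto
qed

lemma empty_in_pi01_classes_within: "{} \<in> pi01_classes_within Q"
proof -
  have "computable_str_set {}"
    unfolding computable_str_set_def by (rule exI[of _ Zero]) (simp add: evals_Zero)
  then show ?thesis
    unfolding pi01_classes_within_def pi01_class_def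
    by (auto simp: is_tree_def paths_def intro!: exI[of _ "{}"])
qed

end

theory Submission
  imports Defs "HOL-Library.Nat_Bijection"
begin

text \<open>
  All five cases are instances of one diagonalization. Let \<open>Q\<close> be a set of reals that is closed
  under prepending bits and contains no real that is eventually equal to a fixed bit \<open>b\<close>, and let
  \<open>P0\<close> be a nonempty effectively closed class within \<open>Q\<close>, with tree \<open>T\<close>. Infinitely many strings
  \<open>\<sigma>\<close> are minimal outside \<open>T\<close>: otherwise some real that is eventually \<open>b\<close> would lie in \<open>P0\<close>. Given a
  numbering of the classes within \<open>Q\<close>, the real \<open>\<sigma> b b b \<dots>\<close> is in none of its classes, so one can
  compute \<open>g \<sigma>\<close> such that \<open>\<sigma>\<close> followed by \<open>g \<sigma>\<close> many \<open>b\<close>'s has left each of the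
  first \<open>str \<sigma> + 1\<close> classes. Adding to \<open>P0\<close>, for every such \<open>\<sigma>\<close>, a copy of \<open>P0\<close> above that string gives
  a class within \<open>Q\<close>, closed because the \<open>\<sigma>\<close> only accumulate at \<open>P0\<close>, that is not in the numbering.
  For random reals \<open>P0\<close> is the complement of a level of a universal Martin-Loef test, which needs
  a step-indexed universal evaluator for \<open>recf\<close>; for finite and cofinite sets it is a singleton.
\<close>

section \<open>Computable functions\<close>

definition recursive :: "nat \<Rightarrow> (nat list \<Rightarrow> nat) \<Rightarrow> bool" where
  "recursive k f \<longleftrightarrow> (\<exists>p. \<forall>xs. length xs = k \<longrightarrow> evals no_oracle p xs (f xs))"

lemma recursive_cong:
  "recursive k f \<Longrightarrow> (\<And>xs. length xs = k \<Longrightarrow> f xs = g xs) \<Longrightarrow> recursive k g"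
  unfolding recursive_def by metis

lemma recursive_zero: "recursive k (\<lambda>_. 0)"
  unfolding recursive_def by (intro exI[of _ Zero]) (simp add: evals_Zero)

lemma recursive_proj: "i < k \<Longrightarrow> recursive k (\<lambda>xs. xs ! i)"
  unfolding recursive_def by (intro exI[of _ "Proj i"]) (simp add: evals_Proj)

lemma recursive_comp:
  assumes "recursive (length gs) f" and "\<And>g. g \<in> set gs \<Longrightarrow> recursive k g"
  shows "recursive k (\<lambda>xs. f (map (\<lambda>g. g xs) gs))"
proof -
  obtain p where p: "\<And>xs. length xs = length gs \<Longrightarrow> evals no_oracle p xs (f xs)"
    using assms(1) unfolding recursive_def by blast
  from assms(2) obtain q where
    q: "\<And>g xs. g \<in> set gs \<Longrightarrow> length xs = k \<Longrightarrow> evals no_oracle (q g) xs (g xs)"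
    unfolding recursive_def by metis
  have "evals no_oracle (Comp p (map q gs)) xs (f (map (\<lambda>g. g xs) gs))" if "length xs = k" for xs
    by (rule evals_Comp[where ys = "map (\<lambda>g. g xs) gs"]) (auto intro!: p q that)
  then show ?thesis unfolding recursive_def by blast
qed

lemma recursive_Suc: "recursive k f \<Longrightarrow> recursive k (\<lambda>xs. Suc (f xs))"
proof -
  assume f: "recursive k f"
  have "recursive (length [f]) (\<lambda>xs. Suc (xs ! 0))"
    unfolding recursive_def
    by (intro exI[of _ Succ]) (auto simp: length_Suc_conv intro: evals_Succ)
  from recursive_comp[OF this, of k] f show ?thesis by simp
qed

text \<open>\<open>PrimRec\<close> recurses on its first argument and keeps the rest as parameters.
  It is run on \<open>h xs # xs\<close>, a list produced by composing with \<open>h\<close> and the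
  \<open>k\<close> projections.\<close>

lemma recursive_rec:
  assumes a: "recursive k a" and h: "recursive k h" and g: "recursive (Suc (Suc k)) g"
  shows "recursive k (\<lambda>xs. rec_nat (a xs) (\<lambda>n z. g (n # z # xs)) (h xs))"
proof -
  obtain p q where p: "\<And>xs. length xs = k \<Longrightarrow> evals no_oracle p xs (a xs)"
    and q: "\<And>xs. length xs = Suc (Suc k) \<Longrightarrow> evals no_oracle q xs (g xs)"
    using a g unfolding recursive_def by blast
  have "evals no_oracle (PrimRec p q) (n # xs) (rec_nat (a xs) (\<lambda>n z. g (n # z # xs)) n)"
    if "length xs = k" for n xs
  proof (induction n)
    case 0
    show ?case using p[OF that] by (simp add: evals_PrimRec_0)
  next
    case (Suc n)
    then show ?case using that by (auto intro!: evals_PrimRec_Suc q)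
  qed
  then have "recursive (Suc k) (\<lambda>l. rec_nat (a (tl l)) (\<lambda>n z. g (n # z # tl l)) (hd l))"
    unfolding recursive_def by (intro exI[of _ "PrimRec p q"]) (auto simp: length_Suc_conv)
  moreover have "length (h # map (\<lambda>i xs. xs ! i) [0..<k]) = Suc k" by simp
  ultimately have "recursive (length (h # map (\<lambda>i xs. xs ! i) [0..<k]))
      (\<lambda>l. rec_nat (a (tl l)) (\<lambda>n z. g (n # z # tl l)) (hd l))"
    by (simp only:)
  moreover have "recursive k f" if "f \<in> set (h # map (\<lambda>i xs. xs ! i) [0..<k])" for f
    using that h by (auto intro: recursive_proj)
  ultimately have "recursive k (\<lambda>xs. rec_nat (a (map (\<lambda>i. xs ! i) [0..<k]))
      (\<lambda>n z. g (n # z # map (\<lambda>i. xs ! i) [0..<k])) (h xs))"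
    using recursive_comp[of "h # map (\<lambda>i xs. xs ! i) [0..<k]" _ k] by (fastforce simp: comp_def)
  then show ?thesis
    by (rule recursive_cong) (metis map_nth)
qed

lemma recursive_Least:
  assumes f: "recursive (Suc k) f" and ex: "\<And>xs. length xs = k \<Longrightarrow> \<exists>n. f (n # xs) = 0"
  shows "recursive k (\<lambda>xs. LEAST n. f (n # xs) = 0)"
proof -
  obtain p where p: "\<And>xs. length xs = Suc k \<Longrightarrow> evals no_oracle p xs (f xs)"
    using f unfolding recursive_def by blast
  have "evals no_oracle (Mu p) xs (LEAST n. f (n # xs) = 0)" if xs: "length xs = k" for xs
  proof (rule evals_Mu)
    have "f ((LEAST n. f (n # xs) = 0) # xs) = 0" using ex[OF xs] by (rule LeastI_ex)
    with p[of "(LEAST n. f (n # xs) = 0) # xs"] xs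
    show "evals no_oracle p ((LEAST n. f (n # xs) = 0) # xs) 0" by simp
    show "\<exists>k. evals no_oracle p (m # xs) (Suc k)" if "m < (LEAST n. f (n # xs) = 0)" for m
      using p[of "m # xs"] not_less_Least[OF that] xs by (metis length_Cons not0_implies_Suc)
  qed
  then show ?thesis unfolding recursive_def by blast
qed

lemma recursive_add:
  assumes "recursive k f" "recursive k g" shows "recursive k (\<lambda>xs. f xs + g xs)"
proof -
  have "recursive k (\<lambda>xs. rec_nat (f xs) (\<lambda>n z. Suc ((n # z # xs) ! 1)) (g xs))"
    by (intro recursive_rec[where g = "\<lambda>l. Suc (l ! 1)"] assms recursive_Suc recursive_proj) simp
  moreover have "rec_nat a (\<lambda>n z. Suc ((n # z # xs) ! 1)) b = a + b" for a b and xs :: "nat list"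
    by (induction b) auto
  ultimately show ?thesis by simp
qed

lemma recursive_pred:
  assumes "recursive k f" shows "recursive k (\<lambda>xs. f xs - 1)"
proof -
  have "recursive k (\<lambda>xs. rec_nat 0 (\<lambda>n z. (n # z # xs) ! 0) (f xs))"
    by (intro recursive_rec[where g = "\<lambda>l. l ! 0"] assms recursive_zero recursive_proj) simp
  moreover have "rec_nat 0 (\<lambda>n z. (n # z # xs) ! 0) b = b - 1" for b and xs :: "nat list"
    by (cases b) auto
  ultimately show ?thesis by simp
qed

lemma recursive_diff:
  assumes "recursive k f" "recursive k g" shows "recursive k (\<lambda>xs. f xs - g xs)"
proof -
  have "recursive k (\<lambda>xs. rec_nat (f xs) (\<lambda>n z. (n # z # xs) ! 1 - 1) (g xs))"
    by (intro recursive_rec[where g = "\<lambda>l. l ! 1 - 1"] assms recursive_pred recursive_proj) simp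
  moreover have "rec_nat a (\<lambda>n z. (n # z # xs) ! 1 - 1) b = a - b" for a b and xs :: "nat list"
    by (induction b) auto
  ultimately show ?thesis by simp
qed

lemma recursive_mult:
  assumes "recursive k f" "recursive k g" shows "recursive k (\<lambda>xs. f xs * g xs)"
proof -
  \<comment> \<open>The step function sees counter and accumulator in front of \<open>xs\<close>, so
    \<open>f\<close> is composed with projections that skip two entries.\<close>
  have "recursive (Suc (Suc k)) (\<lambda>l. f (map (\<lambda>g. g l) (map (\<lambda>i l. l ! Suc (Suc i)) [0..<k])))"
    by (rule recursive_comp) (auto intro: assms recursive_proj)
  then have "recursive (Suc (Suc k)) (\<lambda>l. f (tl (tl l)))"
    by (rule recursive_cong) (auto simp: length_Suc_conv comp_def, metis map_nth)
  then have "recursive (Suc (Suc k)) (\<lambda>l. l ! 1 + f (tl (tl l)))"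
    by (intro recursive_add recursive_proj) simp_all
  from recursive_rec[OF recursive_zero assms(2) this]
  have "recursive k (\<lambda>xs. rec_nat 0 (\<lambda>n z. z + f xs) (g xs))" by simp
  moreover have "rec_nat 0 (\<lambda>n z. z + a) b = a * b" for a b :: nat
    by (induction b) auto
  ultimately show ?thesis by simp
qed

section \<open>Unary computable functions and pairing\<close>

definition computable :: "(nat \<Rightarrow> nat) \<Rightarrow> bool" where
  "computable f \<longleftrightarrow> (\<exists>p. \<forall>x. evals no_oracle p [x] (f x))"

lemma computable_iff_recursive: "computable f \<longleftrightarrow> recursive 1 (\<lambda>xs. f (xs ! 0))"
proof -
  have "(\<forall>x. evals no_oracle p [x] (f x)) \<longleftrightarrow>
      (\<forall>xs. length xs = 1 \<longrightarrow> evals no_oracle p xs (f (xs ! 0)))" for p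
    by (auto simp: length_Suc_conv)
  then show ?thesis unfolding computable_def recursive_def by simp
qed

lemma recursive_comp1:
  assumes "computable f" "recursive k g" shows "recursive k (\<lambda>xs. f (g xs))"
  using recursive_comp[of "[g]" "\<lambda>xs. f (xs ! 0)" k] assms by (simp add: computable_iff_recursive)

lemma computable_comp:
  "computable f \<Longrightarrow> computable g \<Longrightarrow> computable (\<lambda>x. f (g x))"
  using recursive_comp1[of f 1 "\<lambda>xs. g (xs ! 0)"] by (simp add: computable_iff_recursive)

lemma computable_triangle: "computable triangle"
proof -
  have "recursive 1 (\<lambda>xs. rec_nat 0 (\<lambda>n z. (n # z # xs) ! 1 + Suc ((n # z # xs) ! 0)) (xs ! 0))"
    by (intro recursive_rec[where g = "\<lambda>l. l ! 1 + Suc (l ! 0)"] recursive_add recursive_zero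
        recursive_Suc recursive_proj) simp_all
  moreover have "rec_nat 0 (\<lambda>n z. (n # z # xs) ! 1 + Suc ((n # z # xs) ! 0)) b = triangle b"
    for b and xs :: "nat list"
    by (induction b) auto
  ultimately show ?thesis by (simp add: computable_iff_recursive)
qed

lemma recursive_prod_encode:
  "recursive k f \<Longrightarrow> recursive k g \<Longrightarrow> recursive k (\<lambda>xs. prod_encode (f xs, g xs))"
  by (simp add: prod_encode_def recursive_add recursive_comp1[OF computable_triangle])

text \<open>The diagonal \<open>m + n\<close> on which \<open>prod_encode (m, n)\<close> lies is recovered by search.\<close>

lemma prod_encode_diagonal:
  "(LEAST w. prod_encode (m, n) < triangle (Suc w)) = m + n"
proof (rule Least_equality)
  show "prod_encode (m, n) < triangle (Suc (m + n))" by (simp add: prod_encode_def)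
  fix w assume "prod_encode (m, n) < triangle (Suc w)"
  then have *: "triangle (m + n) < triangle (Suc w)" unfolding prod_encode_def by simp
  have "triangle i \<le> triangle j" if "i \<le> j" for i j
    using that by (rule lift_Suc_mono_le[rotated]) simp
  with * show "m + n \<le> w" by (meson leD not_less_eq_eq)
qed

lemma computable_diagonal: "computable (\<lambda>z. LEAST w. z < triangle (Suc w))"
proof -
  \<comment> \<open>Truncated subtraction turns \<open>z < triangle (Suc w)\<close> into a test for
    zero; \<open>w = z\<close> always passes it.\<close>
  have "recursive 2 (\<lambda>xs. Suc (xs ! 1) - triangle (Suc (xs ! 0)))"
    by (intro recursive_diff recursive_Suc recursive_comp1[OF computable_triangle] recursive_proj)
      simp_all
  then have "recursive 1 (\<lambda>xs. LEAST w. Suc ((w # xs) ! 1) - triangle (Suc ((w # xs) ! 0)) = 0)"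
  proof (intro recursive_Least, goal_cases)
    case (2 xs)
    show ?case
      by (rule exI[of _ "xs ! 0"]) simp
  qed (simp add: numeral_2_eq_2)
  moreover have "Suc z - t = 0 \<longleftrightarrow> z < t" for z t :: nat by auto
  ultimately show ?thesis by (simp del: triangle_Suc add: computable_iff_recursive)
qed

text \<open>\<open>prod_encode (m, n)\<close> is \<open>triangle (m + n) + m\<close>, so subtracting
  the triangular number of the diagonal leaves \<open>m\<close>.\<close>

lemma computable_fst_decode: "computable (\<lambda>z. fst (prod_decode z))"
proof -
  have eq: "fst (prod_decode z) = z - triangle (LEAST w. z < triangle (Suc w))" for z
  proof -
    obtain m n where "z = prod_encode (m, n)" by (metis prod_decode_inverse surj_pair)
    then show ?thesis
      by (simp only: prod_encode_diagonal prod_encode_inverse) (simp add: prod_encode_def)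
  qed
  show ?thesis
    unfolding eq computable_iff_recursive
    by (intro recursive_diff recursive_proj recursive_comp1[OF computable_triangle]
        recursive_comp1[OF computable_diagonal]) simp_all
qed

lemma computable_snd_decode: "computable (\<lambda>z. snd (prod_decode z))"
proof -
  have eq: "snd (prod_decode z) = (LEAST w. z < triangle (Suc w)) - fst (prod_decode z)" for z
  proof -
    obtain m n where "z = prod_encode (m, n)" by (metis prod_decode_inverse surj_pair)
    then show ?thesis by (simp only: prod_encode_diagonal) simp
  qed
  show ?thesis
    unfolding eq computable_iff_recursive
    by (intro recursive_diff recursive_proj recursive_comp1[OF computable_fst_decode]
        recursive_comp1[OF computable_diagonal]) simp_all
qed

abbreviation pr1 :: "nat \<Rightarrow> nat" where "pr1 z \<equiv> fst (prod_decode z)"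
abbreviation pr2 :: "nat \<Rightarrow> nat" where "pr2 z \<equiv> snd (prod_decode z)"

named_theorems computable_intros

lemma computable_id [computable_intros]: "computable (\<lambda>x. x)"
  unfolding computable_iff_recursive by (rule recursive_proj) simp

lemma computable_Suc [computable_intros]: "computable f \<Longrightarrow> computable (\<lambda>x. Suc (f x))"
  unfolding computable_iff_recursive by (rule recursive_Suc)

lemma computable_const [computable_intros]: "computable (\<lambda>_. c)"
proof (induction c)
  case 0
  show ?case unfolding computable_iff_recursive by (rule recursive_zero)
qed (rule computable_Suc)

lemma computable_add [computable_intros]:
  "computable f \<Longrightarrow> computable g \<Longrightarrow> computable (\<lambda>x. f x + g x)"
  unfolding computable_iff_recursive by (rule recursive_add)

lemma computable_diff [computable_intros]:
  "computable f \<Longrightarrow> computable g \<Longrightarrow> computable (\<lambda>x. f x - g x)"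
  unfolding computable_iff_recursive by (rule recursive_diff)

lemma computable_mult [computable_intros]:
  "computable f \<Longrightarrow> computable g \<Longrightarrow> computable (\<lambda>x. f x * g x)"
  unfolding computable_iff_recursive by (rule recursive_mult)

lemma computable_prod_encode [computable_intros]:
  "computable f \<Longrightarrow> computable g \<Longrightarrow> computable (\<lambda>x. prod_encode (f x, g x))"
  unfolding computable_iff_recursive by (rule recursive_prod_encode)

lemma computable_pr1 [computable_intros]: "computable f \<Longrightarrow> computable (\<lambda>x. pr1 (f x))"
  by (rule computable_comp[OF computable_fst_decode])

lemma computable_pr2 [computable_intros]: "computable f \<Longrightarrow> computable (\<lambda>x. pr2 (f x))"
  by (rule computable_comp[OF computable_snd_decode])

lemma computable_comp2:
  assumes "computable (\<lambda>p. f (pr1 p) (pr2 p))" "computable g" "computable h"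
  shows "computable (\<lambda>x. f (g x) (h x))"
  using computable_comp[OF assms(1) computable_prod_encode[OF assms(2,3)]] by simp

lemma recursive2_iff: "recursive 2 (\<lambda>xs. f (xs ! 0) (xs ! 1)) \<longleftrightarrow> computable (\<lambda>p. f (pr1 p) (pr2 p))"
proof
  assume "recursive 2 (\<lambda>xs. f (xs ! 0) (xs ! 1))"
  then show "computable (\<lambda>p. f (pr1 p) (pr2 p))"
    using recursive_comp[of "[\<lambda>xs. pr1 (xs ! 0), \<lambda>xs. pr2 (xs ! 0)]" "\<lambda>xs. f (xs ! 0) (xs ! 1)" 1]
      computable_pr1[OF computable_id] computable_pr2[OF computable_id]
    by (fastforce simp: computable_iff_recursive numeral_2_eq_2)
next
  assume "computable (\<lambda>p. f (pr1 p) (pr2 p))"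
  from recursive_comp1[OF this, of 2 "\<lambda>xs. prod_encode (xs ! 0, xs ! 1)"]
  show "recursive 2 (\<lambda>xs. f (xs ! 0) (xs ! 1))"
    by (simp add: recursive_prod_encode recursive_proj)
qed

lemma computable2_iff:
  "computable (\<lambda>p. f (pr1 p) (pr2 p)) \<longleftrightarrow> (\<exists>p. \<forall>x y. evals no_oracle p [x, y] (f x y))"
proof -
  have "(\<forall>xs. length xs = 2 \<longrightarrow> evals no_oracle p xs (f (xs ! 0) (xs ! 1))) \<longleftrightarrow>
      (\<forall>x y. evals no_oracle p [x, y] (f x y))" for p
    by (fastforce simp: length_Suc_conv numeral_2_eq_2)
  then show ?thesis unfolding recursive2_iff[symmetric] recursive_def by simp
qed

lemma computable_rec [computable_intros]:
  assumes a: "computable a" and h: "computable h"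
    and g: "computable (\<lambda>p. g (pr1 p) (pr1 (pr2 p)) (pr2 (pr2 p)))"
  shows "computable (\<lambda>x. rec_nat (a x) (\<lambda>n z. g x n z) (h x))"
proof -
  have "recursive 3 (\<lambda>l. g (l ! 2) (l ! 0) (l ! 1))"
    using recursive_comp1[OF g, of 3 "\<lambda>l. prod_encode (l ! 2, prod_encode (l ! 0, l ! 1))"]
    by (simp add: recursive_prod_encode recursive_proj)
  then have "recursive 1 (\<lambda>xs. rec_nat (a (xs ! 0))
      (\<lambda>n z. g ((n # z # xs) ! 2) ((n # z # xs) ! 0) ((n # z # xs) ! 1)) (h (xs ! 0)))"
    using a h by (intro recursive_rec) (simp_all add: computable_iff_recursive numeral_3_eq_3)
  then show ?thesis by (simp add: computable_iff_recursive)
qed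

section \<open>Decidable predicates, bounded quantifiers and search\<close>

definition decidable :: "(nat \<Rightarrow> bool) \<Rightarrow> bool" where
  "decidable P \<longleftrightarrow> computable (\<lambda>x. of_bool (P x))"

lemma decidable_of_bool [computable_intros]: "decidable P \<Longrightarrow> computable (\<lambda>x. of_bool (P x))"
  by (simp add: decidable_def)

lemma decidable_comp: "decidable P \<Longrightarrow> computable f \<Longrightarrow> decidable (\<lambda>x. P (f x))"
  unfolding decidable_def by (rule computable_comp)

lemma decidable_comp2:
  assumes "decidable (\<lambda>p. P (pr1 p) (pr2 p))" "computable g" "computable h"
  shows "decidable (\<lambda>x. P (g x) (h x))"
  using decidable_comp[OF assms(1) computable_prod_encode[OF assms(2,3)]] by simp

lemma decidable_le [computable_intros]:
  assumes "computable f" "computable g" shows "decidable (\<lambda>x. f x \<le> g x)"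
proof -
  have "of_bool (f x \<le> g x) = 1 - (f x - g x)" for x by auto
  then show ?thesis unfolding decidable_def using assms by (simp add: computable_intros)
qed

lemma decidable_less [computable_intros]:
  assumes "computable f" "computable g" shows "decidable (\<lambda>x. f x < g x)"
  using decidable_le[OF computable_Suc[OF assms(1)] assms(2)] by (simp add: Suc_le_eq)

lemma decidable_not [computable_intros]: "decidable P \<Longrightarrow> decidable (\<lambda>x. \<not> P x)"
proof -
  assume "decidable P"
  then have "computable (\<lambda>x. 1 - of_bool (P x))"
    by (intro computable_intros)
  moreover have "of_bool (\<not> P x) = 1 - (of_bool (P x) :: nat)" for x by simp
  ultimately show ?thesis by (simp only: decidable_def)
qed

lemma decidable_conj [computable_intros]:
  "decidable P \<Longrightarrow> decidable Q \<Longrightarrow> decidable (\<lambda>x. P x \<and> Q x)"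
  unfolding decidable_def of_bool_conj by (intro computable_mult)

lemma decidable_disj [computable_intros]:
  "decidable P \<Longrightarrow> decidable Q \<Longrightarrow> decidable (\<lambda>x. P x \<or> Q x)"
  using decidable_not[OF decidable_conj[of "\<lambda>x. \<not> P x" "\<lambda>x. \<not> Q x"]] by (simp add: decidable_not)

lemma decidable_imp [computable_intros]:
  "decidable P \<Longrightarrow> decidable Q \<Longrightarrow> decidable (\<lambda>x. P x \<longrightarrow> Q x)"
  unfolding imp_conv_disj by (intro computable_intros)

lemma decidable_iff [computable_intros]:
  "decidable P \<Longrightarrow> decidable Q \<Longrightarrow> decidable (\<lambda>x. P x \<longleftrightarrow> Q x)"
  unfolding iff_conv_conj_imp by (intro computable_intros)

lemma decidable_const [computable_intros]: "decidable (\<lambda>_. P)"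
  unfolding decidable_def by (rule computable_const)

lemma decidable_eq [computable_intros]:
  fixes f g :: "nat \<Rightarrow> nat"
  shows "computable f \<Longrightarrow> computable g \<Longrightarrow> decidable (\<lambda>x. f x = g x)"
  unfolding eq_iff by (intro computable_intros)

lemma computable_sum [computable_intros]:
  assumes "computable h" "computable (\<lambda>p. f (pr1 p) (pr2 p))"
  shows "computable (\<lambda>x. \<Sum>i<h x. f x i)"
proof -
  have "(\<Sum>i<n. f x i) = rec_nat 0 (\<lambda>n z. z + f x n) n" for x n
    by (induction n) auto
  moreover have "computable (\<lambda>x. rec_nat 0 (\<lambda>n z. z + f x n) (h x))"
    by (intro computable_intros assms computable_comp2[OF assms(2)])
  ultimately show ?thesis by simp
qed

lemma decidable_ex [computable_intros]:
  assumes "computable h" "decidable (\<lambda>p. P (pr1 p) (pr2 p))"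
  shows "decidable (\<lambda>x. \<exists>i<h x. P x i)"
proof -
  have "(\<exists>i<h x. P x i) \<longleftrightarrow> 0 < (\<Sum>i<h x. of_bool (P x i) :: nat)" for x
    by (subst zero_less_iff_neq_zero) auto
  moreover have "decidable (\<lambda>x. 0 < (\<Sum>i<h x. of_bool (P x i) :: nat))"
    by (intro computable_intros assms)
  ultimately show ?thesis by simp
qed

lemma decidable_all [computable_intros]:
  assumes "computable h" "decidable (\<lambda>p. P (pr1 p) (pr2 p))"
  shows "decidable (\<lambda>x. \<forall>i<h x. P x i)"
  using decidable_not[OF decidable_ex[OF assms(1) decidable_not[OF assms(2)]]] by simp

lemma computable_Least [computable_intros]:
  assumes "decidable (\<lambda>p. P (pr1 p) (pr2 p))" "\<And>x. \<exists>n. P x n"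
  shows "computable (\<lambda>x. LEAST n. P x n)"
proof -
  \<comment> \<open>The search variable of \<open>recursive_Least\<close> comes first and success is
    the value 0, hence the swapped projections and the complement.\<close>
  have "computable (\<lambda>p. 1 - of_bool (P (pr2 p) (pr1 p)))"
    by (intro computable_intros decidable_comp2[OF assms(1)])
  then have "recursive 2 (\<lambda>xs. 1 - of_bool (P (xs ! 1) (xs ! 0)))"
    by (subst recursive2_iff)
  then have "recursive 1 (\<lambda>xs. LEAST n. 1 - of_bool (P ((n # xs) ! 1) ((n # xs) ! 0)) = (0::nat))"
    using assms(2) by (intro recursive_Least) (auto simp: numeral_2_eq_2)
  moreover have "1 - of_bool Q = (0 :: nat) \<longleftrightarrow> Q" for Q by simp
  ultimately show ?thesis by (simp del: One_nat_def add: computable_iff_recursive)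
qed

lemma computable_if [computable_intros]:
  assumes "decidable P" "computable f" "computable g"
  shows "computable (\<lambda>x. if P x then f x else g x)"
proof -
  have "(if P x then f x else g x) = of_bool (P x) * f x + (1 - of_bool (P x)) * g x" for x by simp
  then show ?thesis by (simp only:) (intro computable_intros assms)
qed

lemma decidable_if [computable_intros]:
  "decidable P \<Longrightarrow> decidable Q \<Longrightarrow> decidable R \<Longrightarrow> decidable (\<lambda>x. if P x then Q x else R x)"
  unfolding if_bool_eq_conj by (intro computable_intros)

lemma computable_power [computable_intros]:
  assumes "computable h" shows "computable (\<lambda>x. c ^ h x)"
proof -
  have "c ^ n = rec_nat 1 (\<lambda>_ z. c * z) n" for n by (induction n) auto
  then show ?thesis by (simp only:) (intro computable_intros assms)
qed

section \<open>Strings and trees\<close>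

abbreviation unstr :: "nat \<Rightarrow> bool list" where "unstr \<equiv> inv str"

lemma unstr_str [simp]: "unstr (str \<sigma>) = \<sigma>"
  by (simp add: bij_str bij_is_inj)

lemma str_unstr [simp]: "str (unstr x) = x"
  by (simp add: bij_str bij_is_surj surj_f_inv_f)

lemma length_le_str: "length \<sigma> \<le> str \<sigma>"
  by (induction \<sigma>) auto

lemma str_less: "str \<sigma> < 2 ^ Suc (length \<sigma>)"
proof -
  have "str \<sigma> + 2 \<le> 2 ^ Suc (length \<sigma>)" by (induction \<sigma>) auto
  then show ?thesis by simp
qed

text \<open>The default past the end is \<open>False\<close>, so the predicate is determined, and
  decidable, at every index.\<close>

definition bit_at :: "bool list \<Rightarrow> nat \<Rightarrow> bool" where
  "bit_at \<sigma> i \<longleftrightarrow> i < length \<sigma> \<and> \<sigma> ! i"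

lemma computable_min [computable_intros]:
  "computable f \<Longrightarrow> computable g \<Longrightarrow> computable (\<lambda>x. min (f x) (g x))"
  unfolding min_def by (intro computable_intros)

lemma computable_half [computable_intros]:
  assumes "computable f" shows "computable (\<lambda>x. f x div 2)"
proof -
  have "f x div 2 = (LEAST q. f x < 2 * q + 2)" for x
    by (rule Least_equality[symmetric]) auto
  moreover have "computable (\<lambda>x. LEAST q. f x < 2 * q + 2)"
  proof (intro computable_intros computable_comp[OF assms])
    show "\<exists>n. f x < 2 * n + 2" for x by (rule exI[of _ "f x"]) simp
  qed
  ultimately show ?thesis by simp
qed

lemma decidable_even [computable_intros]:
  assumes "computable f" shows "decidable (\<lambda>x. even (f x))"
proof -
  have "even n \<longleftrightarrow> n = 2 * (n div 2)" for n :: nat by presburger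
  then show ?thesis by (simp only:) (intro computable_intros assms)
qed

text \<open>The code of \<open>b # \<sigma>\<close> is twice that of \<open>\<sigma>\<close> plus 1
  or 2, so \<open>(r - 1) div 2\<close> deletes the first bit and fixes 0. Iterating it makes length
  and bits of a coded string computable.\<close>

lemma str_drop: "str (drop k \<sigma>) = rec_nat (str \<sigma>) (\<lambda>_ r. (r - 1) div 2) k"
proof (induction k)
  case (Suc k)
  have "str (tl \<tau>) = (str \<tau> - 1) div 2" for \<tau> by (cases \<tau>) auto
  from this[of "drop k \<sigma>"] Suc show ?case by (simp add: drop_Suc tl_drop)
qed simp

lemma str_eq_0_iff: "str \<sigma> = 0 \<longleftrightarrow> \<sigma> = []"
  by (cases \<sigma>) auto

lemma computable_length [computable_intros]:
  assumes "computable f" shows "computable (\<lambda>x. length (unstr (f x)))"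
proof -
  have "length \<sigma> = (LEAST k. rec_nat (str \<sigma>) (\<lambda>_ r. (r - 1) div 2) k = 0)" for \<sigma>
    unfolding str_drop[symmetric] str_eq_0_iff
    by (rule Least_equality[symmetric]) auto
  then have eq: "length (unstr x) = (LEAST k. rec_nat x (\<lambda>_ r. (r - 1) div 2) k = 0)" for x
    by (metis str_unstr)
  have "computable (\<lambda>x. length (unstr x))"
    unfolding eq
  proof (intro computable_intros)
    show "\<exists>k. rec_nat x (\<lambda>_ r. (r - 1) div 2) k = 0" for x :: nat
      using str_drop[of "length (unstr x)" "unstr x"] by auto
  qed
  from computable_comp[OF this assms] show ?thesis .
qed

lemma decidable_bit_at [computable_intros]:
  assumes "computable f" "computable g" shows "decidable (\<lambda>x. bit_at (unstr (f x)) (g x))"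
proof -
  \<comment> \<open>What remains after \<open>i\<close> bits has a nonzero even code exactly when it
    begins with \<open>True\<close>.\<close>
  have "bit_at \<sigma> i \<longleftrightarrow> str (drop i \<sigma>) \<noteq> 0 \<and> even (str (drop i \<sigma>))" for \<sigma> i
    by (cases "i < length \<sigma>") (auto simp: bit_at_def simp flip: Cons_nth_drop_Suc)
  then show ?thesis
    unfolding str_drop by (simp only: str_unstr) (intro computable_intros assms)
qed

text \<open>Length and bits determine a string, so its code is found by searching for the only
  number that passes a decidable test. Prefixes and suffixes are reduced to this form below.\<close>

lemma computable_str_map [computable_intros]:
  assumes P: "decidable (\<lambda>p. P (pr1 p) (pr2 p))" and h: "computable h"
  shows "computable (\<lambda>x. str (map (\<lambda>i. P x i) [0..<h x]))"
proof -
  let ?Q = "\<lambda>x y. length (unstr y) = h x \<and> (\<forall>i<h x. bit_at (unstr y) i \<longleftrightarrow> P x i)"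
  have ex: "?Q x (str (map (P x) [0..<h x]))" for x
    by (simp add: bit_at_def)
  have "(LEAST y. ?Q x y) = str (map (P x) [0..<h x])" for x
  proof (rule Least_equality)
    show "?Q x (str (map (P x) [0..<h x]))" by (rule ex)
    fix y assume y: "?Q x y"
    then have "unstr y = map (P x) [0..<h x]"
      by (intro nth_equalityI) (auto simp: bit_at_def)
    then show "str (map (P x) [0..<h x]) \<le> y" by (metis order_refl str_unstr)
  qed
  moreover have "computable (\<lambda>x. LEAST y. ?Q x y)"
    by (intro computable_intros computable_comp[OF h] decidable_comp2[OF P]) (use ex in blast)
  ultimately show ?thesis by simp
qed

lemma take_conv_bit_at: "take k \<sigma> = map (\<lambda>i. bit_at \<sigma> i) [0..<min k (length \<sigma>)]"
  by (rule nth_equalityI) (auto simp: bit_at_def)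

lemma drop_conv_bit_at: "drop k \<sigma> = map (\<lambda>i. bit_at \<sigma> (k + i)) [0..<length \<sigma> - k]"
  by (rule nth_equalityI) (auto simp: bit_at_def)

lemma computable_take [computable_intros]:
  "computable f \<Longrightarrow> computable k \<Longrightarrow> computable (\<lambda>x. str (take (k x) (unstr (f x))))"
  unfolding take_conv_bit_at by (intro computable_intros) (rule computable_comp[of f], assumption, intro computable_intros)+

lemma computable_drop [computable_intros]:
  "computable f \<Longrightarrow> computable k \<Longrightarrow> computable (\<lambda>x. str (drop (k x) (unstr (f x))))"
  unfolding drop_conv_bit_at by (intro computable_intros) (rule computable_comp[of f] computable_comp[of k], assumption, intro computable_intros)+

section \<open>Initial segments, trees and effectively closed classes\<close>

lemma computable_str_set_iff: "computable_str_set D \<longleftrightarrow> decidable (\<lambda>x. unstr x \<in> D)"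
  unfolding computable_str_set_def decidable_def computable_def
  by (metis str_unstr unstr_str)

lemma computable_str_rel_iff: "computable_str_rel R \<longleftrightarrow> decidable (\<lambda>p. (unstr (pr1 p), pr2 p) \<in> R)"
  unfolding computable_str_rel_def decidable_def
    computable2_iff[of "\<lambda>x e. of_bool ((unstr x, e) \<in> R)"]
  by (metis str_unstr unstr_str)

lemma length_initial_segment [simp]: "length (initial_segment X n) = n"
  by (simp add: initial_segment_def)

lemma nth_initial_segment [simp]: "i < n \<Longrightarrow> initial_segment X n ! i = X i"
  by (simp add: initial_segment_def)

lemma take_initial_segment [simp]: "take k (initial_segment X n) = initial_segment X (min k n)"
  by (rule nth_equalityI) auto

lemma drop_initial_segment:
  "drop k (initial_segment X n) = initial_segment (\<lambda>i. X (i + k)) (n - k)"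
  by (rule nth_equalityI) (auto simp: add.commute)

lemma initial_segment_eq_iff:
  "initial_segment X n = initial_segment Y n \<longleftrightarrow> (\<forall>i<n. X i = Y i)"
  by (auto simp: list_eq_iff_nth_eq)

lemma is_tree_take: "is_tree T \<Longrightarrow> \<sigma> \<in> T \<Longrightarrow> take k \<sigma> \<in> T"
  unfolding is_tree_def by (metis append_take_drop_id)

lemma is_tree_initial_segment:
  "is_tree T \<Longrightarrow> initial_segment X n \<in> T \<Longrightarrow> k \<le> n \<Longrightarrow> initial_segment X k \<in> T"
  using is_tree_take[of T "initial_segment X n" k] by (simp add: min_absorb1)

text \<open>Bounding \<open>m\<close> and the prefix length by the length of the string gives a
  decidable tree. Along a path each pair \<open>m\<close>, \<open>n\<close> is tested once the
  length reaches \<open>max m n\<close>.\<close>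

lemma pi01_classI:
  assumes R: "decidable (\<lambda>p. R (pr1 p) (unstr (pr2 p)))"
  shows "pi01_class {X. \<forall>m n. R m (initial_segment X n)}"
proof -
  define T where "T = {\<tau>. \<forall>m<Suc (length \<tau>). \<forall>k<Suc (length \<tau>). R m (take k \<tau>)}"
  have "is_tree T"
    unfolding is_tree_def T_def
  proof (intro allI impI CollectI)
    fix \<sigma> \<tau> m k
    assume "\<sigma> @ \<tau> \<in> {\<tau>. \<forall>m<Suc (length \<tau>). \<forall>k<Suc (length \<tau>). R m (take k \<tau>)}"
      and mk: "m < Suc (length \<sigma>)" "k < Suc (length \<sigma>)"
    then have "R m (take k (\<sigma> @ \<tau>))" by (simp del: take_append)
    with mk show "R m (take k \<sigma>)" by simp
  qed
  moreover have "computable_str_set T"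
  proof -
    have "decidable (\<lambda>x. \<forall>m<Suc (length (unstr x)). \<forall>k<Suc (length (unstr x)).
        R m (unstr (str (take k (unstr x)))))"
      by (intro computable_intros decidable_comp2[OF R])
    then show ?thesis unfolding computable_str_set_iff T_def by simp
  qed
  moreover have "{X. \<forall>m n. R m (initial_segment X n)} = paths T"
  proof (intro set_eqI iffI)
    fix X assume X: "X \<in> paths T"
    have "R m (initial_segment X n)" for m n
    proof -
      have "initial_segment X (max m n) \<in> T" using X by (simp add: paths_def)
      then have "R m (take n (initial_segment X (max m n)))" unfolding T_def by simp
      then show ?thesis by simp
    qed
    then show "X \<in> {X. \<forall>m n. R m (initial_segment X n)}" by simp
  qed (auto simp: paths_def T_def)
  ultimately show ?thesis unfolding pi01_class_def by blast
qed

section \<open>Diagonalization\<close>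

lemma shift_in_imp_in:
  assumes "\<And>X a. X \<in> Q \<Longrightarrow> case_nat a X \<in> Q" "(\<lambda>i. X (i + N)) \<in> Q"
  shows "X \<in> Q"
  using assms(2)
proof (induction N arbitrary: X)
  case (Suc N)
  from Suc.IH[of "\<lambda>i. X (Suc i)"] Suc.prems have "(\<lambda>i. X (Suc i)) \<in> Q" by simp
  then have "case_nat (X 0) (\<lambda>i. X (Suc i)) \<in> Q" by (rule assms(1))
  also have "case_nat (X 0) (\<lambda>i. X (Suc i)) = X" by (auto split: nat.split)
  finally show ?case .
qed simp

theorem no_effective_numbering:
  assumes prepend: "\<And>X a. X \<in> Q \<Longrightarrow> case_nat a X \<in> Q"
    and avoid: "\<And>X N. (\<forall>n\<ge>N. X n = b) \<Longrightarrow> X \<notin> Q"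
    and P0: "P0 \<in> pi01_classes_within Q" "P0 \<noteq> {}"
  shows "\<not> has_effective_numbering (pi01_classes_within Q)"
proof
  assume "has_effective_numbering (pi01_classes_within Q)"
  then obtain R where R: "decidable (\<lambda>p. (unstr (pr1 p), pr2 p) \<in> R)"
    and num: "pi01_classes_within Q = {{X. \<forall>n. (initial_segment X n, e) \<in> R} | e. e \<in> UNIV}"
    unfolding has_effective_numbering_def pi01_product_def computable_str_rel_iff
    by (elim exE conjE) (simp only: mem_Collect_eq case_prod_conv)
  from P0(1) obtain T where T: "is_tree T" and T_dec: "decidable (\<lambda>x. unstr x \<in> T)"
    and P0_eq: "P0 = paths T" and P0_sub: "P0 \<subseteq> Q"
    unfolding pi01_classes_within_def pi01_class_def computable_str_set_iff by blast
  \<comment> \<open>Every class in the numbering lies within \<open>Q\<close>, so a real that is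
    eventually \<open>b\<close> is excluded from it at a finite stage.\<close>
  have avoid_R: "\<exists>n. (initial_segment X n, e) \<notin> R" if "\<forall>n\<ge>N. X n = b" for X N e
  proof (rule ccontr)
    assume "\<not> ?thesis"
    then have "X \<in> {X. \<forall>n. (initial_segment X n, e) \<in> R}" by blast
    moreover have "{X. \<forall>n. (initial_segment X n, e) \<in> R} \<in> pi01_classes_within Q"
      unfolding num by blast
    ultimately show False
      using avoid[OF that] by (auto simp: pi01_classes_within_def)
  qed
  \<comment> \<open>\<open>?pad \<sigma>\<close> is the real \<open>\<sigma>\<close> followed by
    \<open>b\<close> forever; \<open>?G x N\<close> says that, for \<open>\<sigma>\<close> with code
    \<open>x\<close>, it has left the classes numbered \<open>0\<close> to \<open>x\<close> by
    length \<open>N\<close>.\<close>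
  let ?pad = "\<lambda>\<sigma> i. if i < length \<sigma> then bit_at \<sigma> i else b"
  let ?G = "\<lambda>x N. \<forall>e<Suc x. \<exists>k<Suc N. (map (\<lambda>i. ?pad (unstr x) i) [0..<k], e) \<notin> R"
  have G_ex: "\<exists>N. ?G x N" for x
  proof -
    have "\<forall>e. \<exists>k. (initial_segment (?pad (unstr x)) k, e) \<notin> R"
      using avoid_R[of "length (unstr x)" "?pad (unstr x)"] by auto
    from choice[OF this] obtain f
      where f: "(initial_segment (?pad (unstr x)) (f e), e) \<notin> R" for e by blast
    have "?G x (\<Sum>e<Suc x. f e)"
    proof (intro allI impI)
      fix e assume e: "e < Suc x"
      then have "f e \<le> (\<Sum>e<Suc x. f e)" by (intro member_le_sum) auto
      with f[of e] show "\<exists>k<Suc (\<Sum>e<Suc x. f e). (map (?pad (unstr x)) [0..<k], e) \<notin> R"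
        unfolding initial_segment_def by (intro exI[of _ "f e"]) auto
    qed
    then show ?thesis by blast
  qed
  define g where "g x = (LEAST N. ?G x N)" for x
  have g: "?G x (g x)" for x
    unfolding g_def by (rule LeastI_ex[OF G_ex])
  have g_comp: "computable g"
  proof -
    have "computable (\<lambda>x. LEAST N. \<forall>e<Suc x. \<exists>k<Suc N.
        (unstr (str (map (\<lambda>i. ?pad (unstr x) i) [0..<k])), e) \<notin> R)"
    proof (intro computable_intros decidable_comp2[of "\<lambda>x e. (unstr x, e) \<in> R", OF R])
      show "\<exists>N. \<forall>e<Suc x. \<exists>k<Suc N.
          (unstr (str (map (\<lambda>i. ?pad (unstr x) i) [0..<k])), e) \<notin> R" for x
        using G_ex[of x] by (simp only: unstr_str)
    qed
    then show ?thesis unfolding g_def by (simp only: unstr_str)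
  qed
  \<comment> \<open>The prefix of length \<open>k\<close> is minimal outside \<open>T\<close>;
    \<open>0 < k\<close> keeps the truncated \<open>k - 1\<close> meaningful.\<close>
  define exits where "exits k \<sigma> \<longleftrightarrow> 0 < k \<and> k \<le> length \<sigma> \<and> take k \<sigma> \<notin> T \<and> take (k - 1) \<sigma> \<in> T"
    for k \<sigma>
  \<comment> \<open>On a short string only the bits already present are checked, and the suffix is
    \<open>[]\<close>, which is in \<open>T\<close> because \<open>P0\<close> is nonempty.\<close>
  define D where "D k \<sigma> \<longleftrightarrow> (exits k \<sigma> \<longrightarrow>
      (\<forall>i<g (str (take k \<sigma>)). k + i < length \<sigma> \<longrightarrow> (bit_at \<sigma> (k + i) \<longleftrightarrow> b)) \<and>
      drop (k + g (str (take k \<sigma>))) \<sigma> \<in> T)" for k \<sigma>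
  \<comment> \<open>A member of \<open>P\<close> that leaves \<open>T\<close> at stage \<open>k\<close> goes on with \<open>b\<close> until every class of number at
    most the code of its first \<open>k\<close> bits has been left, and then with a member of \<open>P0\<close>.\<close>
  define P where "P = {X. \<forall>k n. D k (initial_segment X n)}"
  have exits_init: "exits k (initial_segment X n) \<longleftrightarrow> k \<le> n \<and> exits k (initial_segment X k)" for k n X
    by (auto simp: exits_def min_def)
  have exits_unique: "k = k'" if "exits k (initial_segment X k)" "exits k' (initial_segment X k')" for X k k'
  proof -
    have "\<not> k < k'" if "exits k (initial_segment X k)" "exits k' (initial_segment X k')" for k k'
    proof
      assume "k < k'"
      then have "k \<le> k' - 1" by simp
      with that is_tree_initial_segment[OF T, of X "k' - 1" k] show False
        by (simp add: exits_def)
    qed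
    with that show ?thesis by (meson nat_neq_iff)
  qed
  have exits_ex: "\<exists>k. exits k (initial_segment X k)" if "X \<notin> P0" for X
  proof -
    from that have ex: "\<exists>k. initial_segment X k \<notin> T" unfolding P0_eq paths_def by blast
    let ?k = "LEAST k. initial_segment X k \<notin> T"
    have "initial_segment X ?k \<notin> T" using ex by (rule LeastI_ex)
    moreover have "initial_segment X 0 \<in> T"
      using P0(2) unfolding P0_eq paths_def by (auto simp: initial_segment_def dest: spec[of _ 0])
    ultimately have "0 < ?k" by (metis neq0_conv)
    moreover from this have "initial_segment X (?k - 1) \<in> T"
      by (metis (no_types, lifting) diff_less less_numeral_extra(1) not_less_Least)
    ultimately show ?thesis using \<open>initial_segment X ?k \<notin> T\<close>
      unfolding exits_def by (intro exI[of _ ?k]) auto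
  qed
  have P_iff: "X \<in> P \<longleftrightarrow> (\<forall>k. exits k (initial_segment X k) \<longrightarrow>
      (\<forall>i<g (str (initial_segment X k)). X (k + i) = b) \<and>
      (\<lambda>i. X (i + (k + g (str (initial_segment X k))))) \<in> P0)" (is "_ \<longleftrightarrow> ?rhs X") for X
  proof
    assume X: "X \<in> P"
    show "?rhs X"
    proof (intro allI impI)
      fix k assume k: "exits k (initial_segment X k)"
      let ?g = "g (str (initial_segment X k))"
      \<comment> \<open>Length \<open>n + k\<close> is enough to see the exit. Taking
        \<open>Suc i\<close> for \<open>n\<close> reveals the bit \<open>k + i\<close>, and
        \<open>n + ?g\<close> reveals \<open>n\<close> bits after the padding.\<close>
      have *: "D k (initial_segment X (n + k))" "exits k (initial_segment X (n + k))" for n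
        using X k exits_init[of k X "n + k"] unfolding P_def by auto
      have "X (k + i) = b" if "i < ?g" for i
        using *[of "Suc i"] that unfolding D_def bit_at_def by (auto simp: add.commute)
      moreover have "initial_segment (\<lambda>i. X (i + (k + ?g))) n \<in> T" for n
        using *[of "n + ?g"] unfolding D_def by (simp add: drop_initial_segment)
      ultimately show "(\<forall>i<?g. X (k + i) = b) \<and> (\<lambda>i. X (i + (k + ?g))) \<in> P0"
        unfolding P0_eq paths_def by blast
    qed
  next
    assume rhs: "?rhs X"
    have "D k (initial_segment X n)" for k n
      unfolding D_def
    proof (intro impI)
      assume "exits k (initial_segment X n)"
      then have "k \<le> n" and k: "exits k (initial_segment X k)"
        using exits_init[of k X n] by auto
      with rhs show "(\<forall>i<g (str (take k (initial_segment X n))). k + i < length (initial_segment X n) \<longrightarrow>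
          bit_at (initial_segment X n) (k + i) = b) \<and>
          drop (k + g (str (take k (initial_segment X n)))) (initial_segment X n) \<in> T"
        unfolding P0_eq paths_def by (auto simp: drop_initial_segment min_absorb1 bit_at_def)
    qed
    then show "X \<in> P" unfolding P_def by blast
  qed
  have "pi01_class P"
    unfolding P_def
  proof (rule pi01_classI)
    have T_dec': "decidable (\<lambda>x. unstr (f x) \<in> T)" if "computable f" for f
      using decidable_comp[OF T_dec that] .
    have "decidable (\<lambda>p. unstr (str (take (pr1 p) (unstr (pr2 p)))) \<in> T)"
         "decidable (\<lambda>p. unstr (str (take (pr1 p - 1) (unstr (pr2 p)))) \<in> T)"
         "decidable (\<lambda>p. unstr (str (drop (pr1 p + g (str (take (pr1 p) (unstr (pr2 p))))) (unstr (pr2 p)))) \<in> T)"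
      by (intro T_dec' computable_intros computable_comp[OF g_comp])+
    then show "decidable (\<lambda>p. D (pr1 p) (unstr (pr2 p)))"
      unfolding D_def exits_def unstr_str
      by (intro computable_intros computable_comp[OF g_comp])
  qed
  moreover have "P \<subseteq> Q"
  proof
    fix X assume X: "X \<in> P"
    show "X \<in> Q"
    proof (cases "X \<in> P0")
      case False
      then obtain k where k: "exits k (initial_segment X k)" using exits_ex by blast
      let ?g = "g (str (initial_segment X k))"
      \<comment> \<open>Behind the padding \<open>X\<close> continues as a member of
        \<open>P0\<close>; prepending bits stays within \<open>Q\<close>.\<close>
      from X k have "(\<lambda>i. X (i + (k + ?g))) \<in> Q" using P0_sub unfolding P_iff by blast
      then show ?thesis by (rule shift_in_imp_in[of Q, rotated]) (rule prepend)
    qed (use P0_sub in auto)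
  qed
  ultimately have "P \<in> pi01_classes_within Q" by (simp add: pi01_classes_within_def)
  then obtain e where e: "P = {X. \<forall>n. (initial_segment X n, e) \<in> R}" unfolding num by blast
  from P0(2) obtain Z where Z: "Z \<in> P0" by blast
  \<comment> \<open>Since \<open>Y\<close> is not in \<open>P0\<close>, it leaves \<open>T\<close>, and it does so late: there are exits with
    arbitrarily large codes, in particular one that handles the number \<open>e\<close>.\<close>
  define Y where "Y i = (if i < e then Z i else b)" for i
  have "Y \<notin> P0" using avoid[of e Y] P0_sub by (auto simp: Y_def)
  then obtain k where k: "exits k (initial_segment Y k)" using exits_ex by blast
  \<comment> \<open>Below \<open>e\<close> the real \<open>Y\<close> agrees with \<open>Z\<close>,
    which never leaves \<open>T\<close>.\<close>
  have "e < k"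
  proof (rule ccontr)
    assume "\<not> e < k"
    then have "initial_segment Y k = initial_segment Z k"
      unfolding initial_segment_eq_iff by (simp add: Y_def)
    with k Z show False unfolding exits_def P0_eq paths_def by auto
  qed
  define x where "x = str (initial_segment Y k)"
  have "e < Suc x" using \<open>e < k\<close> length_le_str[of "initial_segment Y k"] by (simp add: x_def)
  from g[of x, rule_format, OF this] obtain m
    where m: "m < Suc (g x)" "(map (?pad (unstr x)) [0..<m], e) \<notin> R" by blast
  \<comment> \<open>\<open>X\<close> exits where \<open>Y\<close> does, is padded with
    \<open>g x\<close> copies of \<open>b\<close> and ends in \<open>Z\<close>, so it lies in
    \<open>P\<close>. Its first \<open>m\<close> bits already lie outside the class numbered
    \<open>e\<close>, which is \<open>P\<close>.\<close>
  define X where "X i = (if i < k then Y i else if i < k + g x then b else Z (i - (k + g x)))" for i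
  have "map (?pad (unstr x)) [0..<m] = initial_segment X m"
    using m(1) by (intro nth_equalityI) (auto simp: x_def X_def bit_at_def)
  moreover have "X \<in> P"
    unfolding P_iff
  proof (intro allI impI)
    fix k' assume k': "exits k' (initial_segment X k')"
    have XY: "initial_segment X k = initial_segment Y k"
      unfolding initial_segment_eq_iff by (simp add: X_def)
    with exits_unique[OF k'] k have "k' = k" by simp
    with XY Z show "(\<forall>i<g (str (initial_segment X k')). X (k' + i) = b) \<and>
        (\<lambda>i. X (i + (k' + g (str (initial_segment X k'))))) \<in> P0"
      by (simp add: X_def x_def)
  qed
  ultimately show False using m(2) e by auto
qed

section \<open>A universal evaluator\<close>

definition semidecidable :: "(nat \<Rightarrow> bool) \<Rightarrow> bool" where
  "semidecidable P \<longleftrightarrow> (\<exists>D. decidable D \<and> (\<forall>x. P x \<longleftrightarrow> (\<exists>t. D (prod_encode (x, t)))))"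

named_theorems semidecidable_intros

lemma semidecidableI:
  assumes "decidable (\<lambda>p. D (pr1 p) (pr2 p))" "\<And>x. P x \<longleftrightarrow> (\<exists>t. D x t)" shows "semidecidable P"
  unfolding semidecidable_def by (intro exI[of _ "\<lambda>p. D (pr1 p) (pr2 p)"]) (simp add: assms)

lemma semidecidableE:
  assumes "semidecidable P" obtains D where "decidable (\<lambda>p. D (pr1 p) (pr2 p))" "\<And>x. P x \<longleftrightarrow> (\<exists>t. D x t)"
proof -
  from assms obtain D where "decidable D" "\<And>x. P x \<longleftrightarrow> (\<exists>t. D (prod_encode (x, t)))"
    unfolding semidecidable_def by blast
  then show thesis by (intro that[of "\<lambda>x t. D (prod_encode (x, t))"]) auto
qed

lemma semidecidable_decidable: "decidable P \<Longrightarrow> semidecidable P"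
  by (rule semidecidableI[of "\<lambda>x t. P x"]) (simp_all add: decidable_comp[OF _ computable_fst_decode])

lemma semidecidable_eq [semidecidable_intros]:
  fixes f g :: "nat \<Rightarrow> nat"
  shows "computable f \<Longrightarrow> computable g \<Longrightarrow> semidecidable (\<lambda>x. f x = g x)"
  by (intro semidecidable_decidable computable_intros)

lemma semidecidable_less [semidecidable_intros]: "computable f \<Longrightarrow> computable g \<Longrightarrow> semidecidable (\<lambda>x. f x < g x)"
  by (intro semidecidable_decidable computable_intros)

lemma semidecidable_conj [semidecidable_intros]: assumes "semidecidable P" "semidecidable Q" shows "semidecidable (\<lambda>x. P x \<and> Q x)"
proof -
  obtain D E where D: "decidable (\<lambda>p. D (pr1 p) (pr2 p))" "\<And>x. P x \<longleftrightarrow> (\<exists>t. D x t)"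
    and E: "decidable (\<lambda>p. E (pr1 p) (pr2 p))" "\<And>x. Q x \<longleftrightarrow> (\<exists>t. E x t)"
    using assms by (elim semidecidableE) blast
  show ?thesis
  proof (rule semidecidableI[of "\<lambda>x t. D x (pr1 t) \<and> E x (pr2 t)"])
    show "decidable (\<lambda>p. D (pr1 p) (pr1 (pr2 p)) \<and> E (pr1 p) (pr2 (pr2 p)))"
      by (intro computable_intros decidable_comp2[OF D(1)] decidable_comp2[OF E(1)])
    show "P x \<and> Q x \<longleftrightarrow> (\<exists>t. D x (pr1 t) \<and> E x (pr2 t))" for x
      unfolding D(2) E(2) by (metis fst_conv prod_encode_inverse snd_conv)
  qed
qed

lemma semidecidable_disj [semidecidable_intros]: assumes "semidecidable P" "semidecidable Q" shows "semidecidable (\<lambda>x. P x \<or> Q x)"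
proof -
  obtain D E where D: "decidable (\<lambda>p. D (pr1 p) (pr2 p))" "\<And>x. P x \<longleftrightarrow> (\<exists>t. D x t)"
    and E: "decidable (\<lambda>p. E (pr1 p) (pr2 p))" "\<And>x. Q x \<longleftrightarrow> (\<exists>t. E x t)"
    using assms by (elim semidecidableE) blast
  show ?thesis
  proof (rule semidecidableI[of "\<lambda>x t. D x t \<or> E x t"])
    show "decidable (\<lambda>p. D (pr1 p) (pr2 p) \<or> E (pr1 p) (pr2 p))"
      by (intro computable_intros D E)
  qed (auto simp: D(2) E(2))
qed

lemma semidecidable_ex [semidecidable_intros]: assumes "semidecidable (\<lambda>p. P (pr1 p) (pr2 p))" shows "semidecidable (\<lambda>x. \<exists>y. P x y)"
proof -
  obtain D where D: "decidable (\<lambda>p. D (pr1 p) (pr2 p))" "\<And>p. P (pr1 p) (pr2 p) \<longleftrightarrow> (\<exists>t. D p t)"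
    using assms by (elim semidecidableE) blast
  show ?thesis
  proof (rule semidecidableI[of "\<lambda>x t. D (prod_encode (x, pr1 t)) (pr2 t)"])
    show "decidable (\<lambda>p. D (prod_encode (pr1 p, pr1 (pr2 p))) (pr2 (pr2 p)))"
      by (intro computable_intros decidable_comp2[OF D(1)])
    show "(\<exists>y. P x y) \<longleftrightarrow> (\<exists>t. D (prod_encode (x, pr1 t)) (pr2 t))" for x
      using D(2)[of "prod_encode (x, y)" for y] by simp (metis fst_conv prod_encode_inverse snd_conv)
  qed
qed

text \<open>Finitely many witnesses lie below a common bound, here one more than their sum, so the
  unbounded quantifier can be moved to the front.\<close>

lemma semidecidable_all [semidecidable_intros]:
  assumes h: "computable h" and "semidecidable (\<lambda>p. P (pr1 p) (pr2 p))"
  shows "semidecidable (\<lambda>x. \<forall>i<h x. P x i)"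
proof -
  obtain D where D: "decidable (\<lambda>p. D (pr1 p) (pr2 p))" "\<And>p. P (pr1 p) (pr2 p) \<longleftrightarrow> (\<exists>t. D p t)"
    using assms(2) by (elim semidecidableE) blast
  then have P: "P x i \<longleftrightarrow> (\<exists>t. D (prod_encode (x, i)) t)" for x i
    using D(2)[of "prod_encode (x, i)"] by simp
  show ?thesis
  proof (rule semidecidableI[of "\<lambda>x b. \<forall>i<h x. \<exists>t<b. D (prod_encode (x, i)) t"])
    show "decidable (\<lambda>p. \<forall>i<h (pr1 p). \<exists>t<pr2 p. D (prod_encode (pr1 p, i)) t)"
      by (intro computable_intros decidable_comp2[OF D(1)] computable_comp[OF h])
    show "(\<forall>i<h x. P x i) \<longleftrightarrow> (\<exists>b. \<forall>i<h x. \<exists>t<b. D (prod_encode (x, i)) t)" for x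
    proof
      assume "\<forall>i<h x. P x i"
      then have "\<forall>i. \<exists>t. i < h x \<longrightarrow> D (prod_encode (x, i)) t" unfolding P by blast
      from choice[OF this] obtain t where "\<forall>i. i < h x \<longrightarrow> D (prod_encode (x, i)) (t i)" ..
      moreover have "t i < Suc (\<Sum>i<h x. t i)" if "i < h x" for i
        using that by (simp add: less_Suc_eq_le member_le_sum)
      ultimately show "\<exists>b. \<forall>i<h x. \<exists>t<b. D (prod_encode (x, i)) t" by blast
    qed (auto simp: P)
  qed
qed

lemma semidecidable_comp: assumes "semidecidable P" "computable f" shows "semidecidable (\<lambda>x. P (f x))"
proof -
  obtain D where D: "decidable (\<lambda>p. D (pr1 p) (pr2 p))" "\<And>p. P p \<longleftrightarrow> (\<exists>t. D p t)"
    using assms by (elim semidecidableE) blast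
  show ?thesis
    by (rule semidecidableI[of "\<lambda>x t. D (f x) t"])
      (intro computable_intros decidable_comp2[OF D(1)] computable_comp[OF assms(2)], rule D(2))
qed

section \<open>Computing with codes of lists\<close>

definition entry :: "nat list \<Rightarrow> nat \<Rightarrow> nat" where
  "entry xs i = (if i < length xs then xs ! i else 0)"

lemma prod_decode_0: "prod_decode 0 = (0, 0)"
  by (simp add: prod_decode_def prod_decode_aux.simps)

text \<open>A nonempty list has code \<open>Suc (prod_encode (x, r))\<close> with \<open>r\<close>
  the code of its tail, so \<open>pr2 (r - 1)\<close> deletes the head; it fixes 0.\<close>

lemma list_encode_drop: "list_encode (drop k xs) = rec_nat (list_encode xs) (\<lambda>_ r. pr2 (r - 1)) k"
proof (induction k)
  case (Suc k)
  have "list_encode (tl ys) = pr2 (list_encode ys - 1)" for ys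
    by (cases ys) (auto simp: prod_decode_0)
  from this[of "drop k xs"] Suc show ?case by (simp add: drop_Suc tl_drop)
qed simp

lemma list_encode_eq_0_iff: "list_encode xs = 0 \<longleftrightarrow> xs = []"
  by (cases xs) auto

lemma computable_list_length [computable_intros]:
  assumes "computable f" shows "computable (\<lambda>x. length (list_decode (f x)))"
proof -
  have "length xs = (LEAST k. rec_nat (list_encode xs) (\<lambda>_ r. pr2 (r - 1)) k = 0)" for xs
    unfolding list_encode_drop[symmetric] list_encode_eq_0_iff
    by (rule Least_equality[symmetric]) auto
  then have eq: "length (list_decode x) = (LEAST k. rec_nat x (\<lambda>_ r. pr2 (r - 1)) k = 0)" for x
    by (metis list_decode_inverse)
  have "computable (\<lambda>x. length (list_decode x))"
    unfolding eq
  proof (intro computable_intros)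
    show "\<exists>k. rec_nat x (\<lambda>_ r. pr2 (r - 1)) k = 0" for x :: nat
      using list_encode_drop[of "length (list_decode x)" "list_decode x"] by auto
  qed
  from computable_comp[OF this assms] show ?thesis .
qed

lemma computable_entry [computable_intros]:
  assumes "computable f" "computable g" shows "computable (\<lambda>x. entry (list_decode (f x)) (g x))"
proof -
  \<comment> \<open>Past the end both sides are 0, since \<open>prod_decode 0 = (0, 0)\<close>; the
    default of \<open>entry\<close> is chosen for this.\<close>
  have "entry xs i = pr1 (list_encode (drop i xs) - 1)" for xs i
    by (cases "i < length xs")
      (auto simp: entry_def prod_decode_0 simp flip: Cons_nth_drop_Suc)
  then show ?thesis
    unfolding list_encode_drop by (simp only: list_decode_inverse) (intro computable_intros assms)
qed

lemma computable_list_encode_Cons [computable_intros]: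
  "computable f \<Longrightarrow> computable (\<lambda>x. list_encode (xs x)) \<Longrightarrow> computable (\<lambda>x. list_encode (f x # xs x))"
  unfolding list_encode.simps by (intro computable_intros)

lemma computable_list_encode_decode [computable_intros]:
  "computable f \<Longrightarrow> computable (\<lambda>x. list_encode (list_decode (f x)))"
  by simp

section \<open>Derivations as certificates of halting\<close>

fun code :: "recf \<Rightarrow> nat" where
  "code Zero = prod_encode (0, 0)"
| "code Succ = prod_encode (1, 0)"
| "code (Proj i) = prod_encode (2, i)"
| "code Oracle = prod_encode (3, 0)"
| "code (Comp f gs) = prod_encode (4, prod_encode (code f, list_encode (map code gs)))"
| "code (PrimRec f g) = prod_encode (5, prod_encode (code f, code g))"
| "code (Mu f) = prod_encode (6, code f)"

abbreviation fact_code :: "nat \<Rightarrow> nat \<Rightarrow> nat \<Rightarrow> nat" where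
  "fact_code c v y \<equiv> prod_encode (c, prod_encode (v, y))"

text \<open>
  A fact \<open>fact_code c v y\<close> says that the program with code \<open>c\<close> maps the argument list with code
  \<open>v\<close> to \<open>y\<close> (without oracle). It follows from the set \<open>F\<close> if one rule of \<open>evals\<close> derives it with
  all premises in \<open>F\<close>. In a derivation each fact follows from the later entries of the list.
\<close>

definition follows :: "nat set \<Rightarrow> nat \<Rightarrow> nat \<Rightarrow> nat \<Rightarrow> bool" where
  "follows F c v y \<longleftrightarrow>
    (pr1 c = 0 \<and> y = 0) \<or>
    (pr1 c = 1 \<and> (\<exists>x. v = list_encode [x] \<and> y = Suc x)) \<or>
    (pr1 c = 2 \<and> pr2 c < length (list_decode v) \<and> y = entry (list_decode v) (pr2 c)) \<or>
    (pr1 c = 3 \<and> (\<exists>x. v = list_encode [x]) \<and> y = 0) \<or>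
    (pr1 c = 4 \<and> (\<exists>w. length (list_decode w) = length (list_decode (pr2 (pr2 c))) \<and>
      (\<forall>i<length (list_decode w).
        fact_code (entry (list_decode (pr2 (pr2 c))) i) v (entry (list_decode w) i) \<in> F) \<and>
      fact_code (pr1 (pr2 c)) w y \<in> F)) \<or>
    (pr1 c = 5 \<and> (\<exists>r. v = list_encode (0 # list_decode r) \<and> fact_code (pr1 (pr2 c)) r y \<in> F)) \<or>
    (pr1 c = 5 \<and> (\<exists>n r z. v = list_encode (Suc n # list_decode r) \<and>
      fact_code c (list_encode (n # list_decode r)) z \<in> F \<and>
      fact_code (pr2 (pr2 c)) (list_encode (n # z # list_decode r)) y \<in> F)) \<or>
    (pr1 c = 6 \<and> fact_code (pr2 c) (list_encode (y # list_decode v)) 0 \<in> F \<and>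
      (\<forall>m<y. \<exists>k. fact_code (pr2 c) (list_encode (m # list_decode v)) (Suc k) \<in> F))"

fun derivation :: "nat list \<Rightarrow> bool" where
  "derivation [] \<longleftrightarrow> True"
| "derivation (z # L) \<longleftrightarrow> follows (set L) (pr1 z) (pr1 (pr2 z)) (pr2 (pr2 z)) \<and> derivation L"

definition derivable :: "nat \<Rightarrow> bool" where
  "derivable z \<longleftrightarrow> (\<exists>L. derivation L \<and> z \<in> set L)"

text \<open>\<open>F\<close> occurs only positively in the rules. Hence derivations can be
  concatenated.\<close>

lemma follows_mono: "follows F c v y \<Longrightarrow> F \<subseteq> G \<Longrightarrow> follows G c v y"
  unfolding follows_def by (elim disjE) (simp_all, blast+)

lemma derivation_append: "derivation L \<Longrightarrow> derivation M \<Longrightarrow> derivation (L @ M)"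
  by (induction L) (auto elim: follows_mono)

text \<open>Derivations of the finitely many premises are concatenated and the new fact is put in
  front.\<close>

lemma derivable_step:
  assumes "follows F c v y" "finite F" "\<And>z. z \<in> F \<Longrightarrow> derivable z"
  shows "derivable (fact_code c v y)"
proof -
  have "\<exists>L. derivation L \<and> F \<subseteq> set L"
    using assms(2,3)
  proof (induction F)
    case empty
    show ?case by (rule exI[of _ "[]"]) simp
  next
    case (insert z F)
    then obtain L M where "derivation L" "F \<subseteq> set L" "derivation M" "z \<in> set M"
      unfolding derivable_def by blast
    then show ?case by (intro exI[of _ "L @ M"]) (auto intro: derivation_append)
  qed
  then obtain L where "derivation L" "F \<subseteq> set L" by blast
  with assms(1) have "derivation (fact_code c v y # L)" by (auto elim: follows_mono)
  then show ?thesis unfolding derivable_def by (meson list.set_intros(1))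
qed

lemma derivable_evals: "evals no_oracle p xs y \<Longrightarrow> derivable (fact_code (code p) (list_encode xs) y)"
proof (induction rule: evals.induct)
  case (evals_Zero xs)
  show ?case by (rule derivable_step[of "{}"]) (auto simp: follows_def)
next
  case (evals_Succ x)
  show ?case by (rule derivable_step[of "{}"]) (auto simp: follows_def)
next
  case (evals_Proj i xs)
  then show ?case by (intro derivable_step[of "{}"]) (auto simp: follows_def entry_def)
next
  case (evals_Oracle x)
  show ?case by (rule derivable_step[of "{}"]) (auto simp: follows_def)
next
  case (evals_Comp ys gs xs f y)
  let ?F = "insert (fact_code (code f) (list_encode ys) y)
    ((\<lambda>i. fact_code (code (gs ! i)) (list_encode xs) (ys ! i)) ` {..<length gs})"
  show ?case
  proof (rule derivable_step[of ?F])
    show "follows ?F (code (Comp f gs)) (list_encode xs) y"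
      using evals_Comp.hyps(1)
      by (auto simp: follows_def entry_def intro!: exI[of _ "list_encode ys"])
  qed (use evals_Comp.IH in auto)
next
  case (evals_PrimRec_0 f xs y g)
  then show ?case
    by (intro derivable_step[of "{fact_code (code f) (list_encode xs) y}"])
      (auto simp: follows_def intro!: exI[of _ "list_encode xs"])
next
  case (evals_PrimRec_Suc f g n xs z y)
  let ?F = "{fact_code (code (PrimRec f g)) (list_encode (n # xs)) z,
    fact_code (code g) (list_encode (n # z # xs)) y}"
  show ?case
  proof (rule derivable_step[of ?F])
    show "follows ?F (code (PrimRec f g)) (list_encode (Suc n # xs)) y"
      unfolding follows_def
      by (simp, intro exI[of _ n] exI[of _ "list_encode xs"] exI[of _ z]) simp
  qed (use evals_PrimRec_Suc.IH in auto)
next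
  case (evals_Mu f n xs)
  \<comment> \<open>A derivation must list one particular nonzero value for each smaller argument,
    so these values are chosen.\<close>
  from evals_Mu.IH(2) have "\<forall>m. \<exists>k. m < n \<longrightarrow> derivable (fact_code (code f) (list_encode (m # xs)) (Suc k))"
    by blast
  from choice[OF this] obtain k
    where k: "m < n \<Longrightarrow> derivable (fact_code (code f) (list_encode (m # xs)) (Suc (k m)))" for m by blast
  let ?F = "insert (fact_code (code f) (list_encode (n # xs)) 0)
    ((\<lambda>m. fact_code (code f) (list_encode (m # xs)) (Suc (k m))) ` {..<n})"
  show ?case
  proof (rule derivable_step[of ?F])
    show "follows ?F (code (Mu f)) (list_encode xs) n"
      unfolding follows_def by auto
  qed (use evals_Mu.IH(1) k in auto)
qed

text \<open>The tag of \<open>code p\<close> selects the rules for the constructor of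
  \<open>p\<close>, and their premises concern only \<open>p\<close> or its direct subprograms. So
  \<open>F\<close> need only be sound for codes of actual programs.\<close>

lemma follows_sound:
  assumes F: "\<And>q zs z. fact_code (code q) (list_encode zs) z \<in> F \<Longrightarrow> evals no_oracle q zs z"
    and "follows F (code p) (list_encode xs) y"
  shows "evals no_oracle p xs y"
proof (cases p)
  case Zero
  with assms(2) show ?thesis by (auto simp: follows_def intro: evals_Zero)
next
  case Succ
  with assms(2) show ?thesis
    by (auto simp: follows_def list_encode_eq simp del: list_encode.simps intro: evals_Succ)
next
  case (Proj i)
  with assms(2) show ?thesis by (auto simp: follows_def entry_def intro: evals_Proj)
next
  case Oracle
  with assms(2) show ?thesis
    using evals_Oracle[of no_oracle] by (auto simp: follows_def list_encode_eq simp del: list_encode.simps)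
next
  case (Comp f gs)
  with assms(2) obtain w where w: "length (list_decode w) = length gs"
    "\<And>i. i < length gs \<Longrightarrow> fact_code (code (gs ! i)) (list_encode xs) (list_decode w ! i) \<in> F"
    "fact_code (code f) w y \<in> F"
    by (auto simp: follows_def entry_def)
  from w(3) have "evals no_oracle f (list_decode w) y" by (intro F) simp
  with w show ?thesis unfolding Comp by (intro evals_Comp[where ys = "list_decode w"] F) auto
next
  case (PrimRec f g)
  from assms(2) consider
    (z) r where "list_encode xs = list_encode (0 # list_decode r)" "fact_code (code f) r y \<in> F"
  | (s) n r z where "list_encode xs = list_encode (Suc n # list_decode r)"
      "fact_code (code p) (list_encode (n # list_decode r)) z \<in> F"
      "fact_code (code g) (list_encode (n # z # list_decode r)) y \<in> F"
    unfolding follows_def PrimRec by (auto simp del: list_encode.simps)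
  then show ?thesis
  proof cases
    case z
    from z(2) have "evals no_oracle f (list_decode r) y" by (intro F) simp
    moreover from z(1) have "xs = 0 # list_decode r" unfolding list_encode_eq .
    ultimately show ?thesis unfolding PrimRec by (simp add: evals_PrimRec_0)
  next
    case s
    from s(1) have "xs = Suc n # list_decode r" unfolding list_encode_eq .
    with F[OF s(2)] F[OF s(3)] show ?thesis unfolding PrimRec by (auto intro: evals_PrimRec_Suc)
  qed
next
  case (Mu f)
  with assms(2) have "fact_code (code f) (list_encode (y # xs)) 0 \<in> F"
    "\<And>m. m < y \<Longrightarrow> \<exists>k. fact_code (code f) (list_encode (m # xs)) (Suc k) \<in> F"
    unfolding follows_def by (auto simp del: list_encode.simps)
  then show ?thesis unfolding Mu by (intro evals_Mu) (auto intro: F simp del: list_encode.simps)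
qed

lemma evals_derivable: "derivable (fact_code (code p) (list_encode xs) y) \<longleftrightarrow> evals no_oracle p xs y"
proof
  have "fact_code (code p) (list_encode xs) y \<in> set L \<Longrightarrow> evals no_oracle p xs y"
    if "derivation L" for L p xs y
    using that
  proof (induction L arbitrary: p xs y)
    case (Cons z L)
    show ?case
    proof (cases "fact_code (code p) (list_encode xs) y \<in> set L")
      case False
      with Cons.prems have "follows (set L) (code p) (list_encode xs) y" by auto
      then show ?thesis by (rule follows_sound[rotated]) (use Cons in auto)
    qed (use Cons in auto)
  qed simp
  then show "derivable (fact_code (code p) (list_encode xs) y) \<Longrightarrow> evals no_oracle p xs y"
    unfolding derivable_def by blast
qed (rule derivable_evals)

text \<open>Recursion on the list is replaced by bounded quantifiers over positions, to which the
  closure rules for semidecidability apply.\<close>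

lemma derivation_iff:
  "derivation L \<longleftrightarrow> (\<forall>i<length L. follows {a. \<exists>j<length L. i < j \<and> entry L j = a}
     (pr1 (entry L i)) (pr1 (pr2 (entry L i))) (pr2 (pr2 (entry L i))))"
proof (induction L)
  case (Cons z L)
  have Cons_entry: "entry (z # L) (Suc i) = entry L i" "entry (z # L) 0 = z" for i
    by (simp_all add: entry_def)
  have "{a. \<exists>j<length L. entry L j = a} = set L"
    unfolding set_conv_nth by (rule Collect_cong) (metis entry_def)
  then show ?case
    using Cons.IH by (simp add: All_less_Suc2 Ex_less_Suc2 Cons_entry)
qed simp

lemma semidecidable_derivable: "semidecidable derivable"
proof -
  have "derivable z \<longleftrightarrow> (\<exists>l. derivation (list_decode l) \<and>
      (\<exists>i<length (list_decode l). entry (list_decode l) i = z))" for z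
    unfolding derivable_def
    by (metis (no_types, opaque_lifting) entry_def in_set_conv_nth list_encode_inverse)
  then have eq: "derivable = (\<lambda>z. \<exists>l. derivation (list_decode l) \<and>
      (\<exists>i<length (list_decode l). entry (list_decode l) i = z))" by (rule ext)
  show ?thesis
    unfolding eq derivation_iff follows_def mem_Collect_eq
    by (intro semidecidable_intros computable_intros)
qed

text \<open>One decidable relation enumerates all sequences that are \<open>uniformly_ce\<close>,
  with the code of the program as an index. The searches for an output and for its derivation are
  merged into \<open>t\<close>.\<close>

theorem halting_semidecidable:
  obtains H where "decidable (\<lambda>p. H (pr1 p) (pr1 (pr2 p)) (pr1 (pr2 (pr2 p))) (pr2 (pr2 (pr2 p))))"
    and "\<And>p n x. (\<exists>y. evals no_oracle p [n, x] y) \<longleftrightarrow> (\<exists>t. H (code p) n x t)"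
proof -
  have "semidecidable (\<lambda>u. \<exists>y. derivable (fact_code (pr1 u) (list_encode [pr1 (pr2 u), pr2 (pr2 u)]) y))"
    by (intro semidecidable_intros semidecidable_comp[OF semidecidable_derivable] computable_intros)
  then obtain D where D: "decidable (\<lambda>p. D (pr1 p) (pr2 p))" and
    eq: "\<And>u. (\<exists>y. derivable (fact_code (pr1 u) (list_encode [pr1 (pr2 u), pr2 (pr2 u)]) y)) \<longleftrightarrow>
      (\<exists>t. D u t)"
    by (rule semidecidableE) blast
  show thesis
  proof (rule that[of "\<lambda>c n x t. D (prod_encode (c, prod_encode (n, x))) t"])
    show "decidable (\<lambda>p. D (prod_encode (pr1 p, prod_encode (pr1 (pr2 p), pr1 (pr2 (pr2 p)))))
        (pr2 (pr2 (pr2 p))))"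
      by (intro decidable_comp2[OF D] computable_intros)
    show "(\<exists>y. evals no_oracle p [n, x] y) \<longleftrightarrow> (\<exists>t. D (prod_encode (code p, prod_encode (n, x))) t)"
      for p n x
      using eq[of "prod_encode (code p, prod_encode (n, x))"]
      by (simp only: prod_encode_inverse fst_conv snd_conv evals_derivable)
  qed
qed

section \<open>Martin-Loef random reals\<close>

lemma prob_space_coin: "prob_space coin_measure"
  unfolding coin_measure_def by (intro prob_space_PiM measure_pmf.prob_space_axioms)

interpretation coin: prob_space coin_measure
  by (rule prob_space_coin)

lemma space_coin [simp]: "space coin_measure = UNIV"
  by (simp add: coin_measure_def space_PiM)

abbreviation cylinders :: "bool list set \<Rightarrow> cantor set" where
  "cylinders V \<equiv> (\<Union>\<sigma>\<in>V. cylinder \<sigma>)"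

lemma cylinders_measurable [measurable]: "cylinders V \<in> sets coin_measure"
  by (rule sets.countable_UN') (auto intro: cylinder_measurable countableI_type)

lemma mem_cylinder_iff: "X \<in> cylinder \<sigma> \<longleftrightarrow> initial_segment X (length \<sigma>) = \<sigma>"
  by (simp add: cylinder_def)

lemma mem_cylinder_Cons: "X \<in> cylinder \<sigma> \<Longrightarrow> case_nat a X \<in> cylinder (a # \<sigma>)"
  by (auto simp: cylinder_eq nth_Cons split: nat.split)

text \<open>Prepending an independent fair bit preserves the coin measure. The set
  \<open>{a} \<times> B\<close> has half the measure of \<open>B\<close> and lies in the preimage of
  \<open>A\<close>.\<close>

lemma measure_case_nat_le:
  assumes A: "A \<in> sets coin_measure" and B: "B \<in> sets coin_measure"
    and sub: "\<And>X. X \<in> B \<Longrightarrow> case_nat a X \<in> A"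
  shows "measure coin_measure B \<le> 2 * measure coin_measure A"
proof -
  let ?M = "measure_pmf (bernoulli_pmf (1/2))"
  interpret sequence_space ?M
    by unfold_locales
  let ?f = "\<lambda>(s, \<omega>). case_nat s \<omega> :: cantor"
  have f: "?f \<in> measurable (?M \<Otimes>\<^sub>M S) S" by measurable
  note A' = A[unfolded coin_measure_def] and B' = B[unfolded coin_measure_def]
  have "ennreal (1/2) * emeasure S B = emeasure (?M \<Otimes>\<^sub>M S) ({a} \<times> B)"
    using B' by (subst P.emeasure_pair_measure_Times)
      (cases a; auto simp: emeasure_pmf_single)+
  also have "\<dots> \<le> emeasure (?M \<Otimes>\<^sub>M S) (?f -` A \<inter> space (?M \<Otimes>\<^sub>M S))"
    using sub f A' by (intro emeasure_mono measurable_sets) (auto simp: space_pair_measure space_PiM)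
  also have "\<dots> = emeasure (distr (?M \<Otimes>\<^sub>M S) S ?f) A"
    using f A' by (simp add: emeasure_distr)
  also have "\<dots> = emeasure S A" by (simp add: PiM_iter)
  finally have "ennreal (1/2) * emeasure coin_measure B \<le> emeasure coin_measure A"
    by (simp add: coin_measure_def)
  moreover have "ennreal (1/2) * emeasure coin_measure B = ennreal (1/2 * measure coin_measure B)"
    unfolding coin.emeasure_eq_measure by (rule ennreal_mult[symmetric]) simp_all
  ultimately have "1/2 * measure coin_measure B \<le> measure coin_measure A"
    by (simp add: coin.emeasure_eq_measure)
  then show ?thesis by simp
qed

section \<open>Martin-Loef tests, computable reals and prepending\<close>

lemma evals_Comp2_iff:
  assumes "evals A q xs a" "evals A r xs b"
  shows "evals A (Comp p [q, r]) xs y \<longleftrightarrow> evals A p [a, b] y"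
proof
  assume "evals A (Comp p [q, r]) xs y"
  then obtain ys where ys: "length ys = length [q, r]"
    "\<And>i. i < length [q, r] \<Longrightarrow> evals A ([q, r] ! i) xs (ys ! i)" "evals A p ys y"
    by (rule evals_CompE) blast
  from ys(2)[of 0] ys(2)[of 1] assms have "ys ! 0 = a" "ys ! 1 = b"
    by (auto dest: evals_deterministic)
  with ys(1) have "ys = [a, b]" by (auto simp: length_Suc_conv)
  with ys(3) show "evals A p [a, b] y" by simp
next
  assume "evals A p [a, b] y"
  then show "evals A (Comp p [q, r]) xs y"
    by (intro evals_Comp[where ys = "[a, b]"]) (auto simp: less_Suc_eq nth_Cons' assms)
qed

text \<open>The search runs over a variable that the tested condition ignores: it stops at 0 if the
  condition holds and never otherwise.\<close>

lemma uniformly_ceI: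
  assumes "decidable (\<lambda>p. unstr (pr2 p) \<in> V (pr1 p))"
  shows "uniformly_ce V"
proof -
  have "computable (\<lambda>p. 1 - of_bool (unstr (pr2 p) \<in> V (pr1 p)))"
    using assms by (intro computable_intros)
  from recursive_comp1[OF this, of 3 "\<lambda>l. prod_encode (l ! 1, l ! 2)"]
  have "recursive 3 (\<lambda>l. 1 - of_bool (unstr (l ! 2) \<in> V (l ! 1)))"
    by (simp add: recursive_prod_encode recursive_proj)
  then obtain p where "\<And>l. length l = 3 \<Longrightarrow> evals no_oracle p l (1 - of_bool (unstr (l ! 2) \<in> V (l ! 1)))"
    unfolding recursive_def by blast
  from this[of "[m, n, str \<sigma>]" for m n \<sigma>]
  have p: "evals no_oracle p [m, n, str \<sigma>] (1 - of_bool (\<sigma> \<in> V n))" for m n \<sigma> by simp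
  have "\<sigma> \<in> V n \<longleftrightarrow> (\<exists>y. evals no_oracle (Mu p) [n, str \<sigma>] y)" for n \<sigma>
  proof
    assume "\<sigma> \<in> V n"
    with p[of 0 n \<sigma>] have "evals no_oracle (Mu p) [n, str \<sigma>] 0" by (intro evals_Mu) simp_all
    then show "\<exists>y. evals no_oracle (Mu p) [n, str \<sigma>] y" ..
  next
    assume "\<exists>y. evals no_oracle (Mu p) [n, str \<sigma>] y"
    then obtain y where "evals no_oracle p [y, n, str \<sigma>] 0" by (auto elim: evals_MuE)
    from evals_deterministic[OF this p] show "\<sigma> \<in> V n" by (cases "\<sigma> \<in> V n") simp_all
  qed
  then show ?thesis unfolding uniformly_ce_def by blast
qed

lemma computable_real_iff_decidable: "computable_real X \<longleftrightarrow> decidable X"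
  by (simp add: computable_real_def decidable_def computable_def)

text \<open>The finitely many exceptional bits are built into the program as a constant.\<close>

lemma eventually_constant_computable:
  assumes "\<forall>n\<ge>N. X n = b" shows "computable_real X"
proof -
  let ?\<sigma> = "initial_segment X N"
  have "X = (\<lambda>n. if n < N then bit_at (unstr (str ?\<sigma>)) n else b)"
    using assms by (intro ext) (simp add: bit_at_def)
  moreover have "decidable (\<lambda>n. if n < N then bit_at (unstr (str ?\<sigma>)) n else b)"
    by (intro computable_intros)
  ultimately show ?thesis unfolding computable_real_iff_decidable by (simp only:)
qed

text \<open>The initial segments of \<open>X\<close> form a test: level \<open>n\<close> is one
  cylinder of measure \<open>(1/2) ^ n\<close>.\<close>

lemma computable_not_ml_random:
  assumes "computable_real X" shows "\<not> ml_random X"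
proof -
  let ?V = "\<lambda>n. {initial_segment X n}"
  have X: "decidable X" using assms by (simp add: computable_real_iff_decidable)
  have "unstr y = initial_segment X n \<longleftrightarrow> y = str (map X [0..<n])" for y n
    unfolding initial_segment_def by (metis str_unstr unstr_str)
  moreover have "decidable (\<lambda>p. pr2 p = str (map (\<lambda>i. X i) [0..<pr1 p]))"
    by (intro computable_intros decidable_comp[OF X])
  ultimately have "uniformly_ce ?V" by (intro uniformly_ceI) simp
  then have "ml_test ?V" by (simp add: ml_test_def measure_cylinder)
  moreover have "X \<in> (\<Inter>n. cylinders (?V n))" by (simp add: mem_cylinder_iff)
  ultimately show ?thesis unfolding ml_random_def by blast
qed

text \<open>From a test that captures \<open>case_nat a X\<close>, deleting the leading
  \<open>a\<close> gives one that captures \<open>X\<close>. Measure at most doubles, which the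
  shift by one level makes up for.\<close>

lemma ml_random_case_nat:
  assumes "ml_random X" shows "ml_random (case_nat a X)"
proof (rule ccontr)
  assume "\<not> ml_random (case_nat a X)"
  then obtain V where V: "ml_test V" and X: "case_nat a X \<in> (\<Inter>n. cylinders (V n))"
    unfolding ml_random_def by blast
  from V obtain p where p: "\<And>n \<sigma>. \<sigma> \<in> V n \<longleftrightarrow> (\<exists>y. evals no_oracle p [n, str \<sigma>] y)"
    unfolding ml_test_def uniformly_ce_def by blast
  \<comment> \<open>The empty string would cover the whole space, but level \<open>Suc n\<close> has
    measure at most \<open>1/2\<close>. So every capturing string has a first bit to delete.\<close>
  have nil: "[] \<notin> V (Suc n)" for n
  proof
    assume "[] \<in> V (Suc n)"
    then have "cylinders (V (Suc n)) = UNIV" by (auto simp: cylinder_eq)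
    then have "measure coin_measure (cylinders (V (Suc n))) = 1"
      using coin.prob_space by simp
    moreover have "measure coin_measure (cylinders (V (Suc n))) \<le> (1/2) ^ Suc n"
      using V unfolding ml_test_def by blast
    moreover have "(1/2 :: real) ^ Suc n \<le> 1/2"
      using power_le_one[of "1/2 :: real" n] by simp
    ultimately show False by linarith
  qed
  define W where "W n = {\<sigma>. a # \<sigma> \<in> V (Suc n)}" for n
  have "computable (\<lambda>p. 2 * pr2 p + (if a then 2 else 1))"
    by (intro computable_intros)
  then obtain q where q: "\<And>n x. evals no_oracle q [n, x] (2 * x + (if a then 2 else 1))"
    using computable2_iff[of "\<lambda>n x. 2 * x + (if a then 2 else 1)"] by blast
  have "computable (\<lambda>p. Suc (pr1 p))" by (intro computable_intros)
  then obtain r where r: "\<And>n x. evals no_oracle r [n, x] (Suc n)"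
    using computable2_iff[of "\<lambda>n x. Suc n"] by blast
  have "\<sigma> \<in> W n \<longleftrightarrow> (\<exists>y. evals no_oracle (Comp p [r, q]) [n, str \<sigma>] y)" for n \<sigma>
    unfolding evals_Comp2_iff[OF r q] W_def mem_Collect_eq p by simp
  then have "uniformly_ce W" unfolding uniformly_ce_def by blast
  moreover have "measure coin_measure (cylinders (W n)) \<le> (1/2) ^ n" for n
  proof -
    have "measure coin_measure (cylinders (W n)) \<le> 2 * measure coin_measure (cylinders (V (Suc n)))"
      by (rule measure_case_nat_le[OF cylinders_measurable cylinders_measurable, where a = a])
        (auto simp: W_def dest: mem_cylinder_Cons)
    moreover have "measure coin_measure (cylinders (V (Suc n))) \<le> (1/2) ^ Suc n"
      using V unfolding ml_test_def by blast
    ultimately show ?thesis by simp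
  qed
  ultimately have "ml_test W" unfolding ml_test_def by blast
  moreover have "X \<in> cylinders (W n)" for n
  proof -
    from X obtain \<sigma> where \<sigma>: "\<sigma> \<in> V (Suc n)" "case_nat a X \<in> cylinder \<sigma>" by blast
    with nil[of n] obtain c \<tau> where "\<sigma> = c # \<tau>" by (cases \<sigma>) auto
    with \<sigma> have "\<sigma> = a # \<tau>" "X \<in> cylinder \<tau>" unfolding cylinder_eq by (force, force)
    with \<sigma>(1) show ?thesis unfolding W_def by blast
  qed
  ultimately show False using assms unfolding ml_random_def by blast
qed

section \<open>Measuring by counting strings\<close>

text \<open>Extending all strings to the common length \<open>s\<close> makes the cylinders disjoint
  and of equal measure.\<close>

lemma measure_cylinders_count:
  assumes "\<And>\<sigma>. \<sigma> \<in> F \<Longrightarrow> length \<sigma> \<le> s"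
  shows "measure coin_measure (cylinders F) =
    card {\<tau>. length \<tau> = s \<and> (\<exists>k\<le>s. take k \<tau> \<in> F)} / 2 ^ s"
proof -
  let ?E = "{\<tau>. length \<tau> = s \<and> (\<exists>k\<le>s. take k \<tau> \<in> F)}"
  have "finite {\<tau>. set \<tau> \<subseteq> (UNIV :: bool set) \<and> length \<tau> = s}" by (rule finite_lists_length_eq) simp
  then have fin: "finite ?E" by (rule rev_finite_subset) auto
  have "cylinders F = cylinders ?E"
  proof (intro set_eqI iffI)
    fix X assume "X \<in> cylinders F"
    then obtain \<sigma> where \<sigma>: "\<sigma> \<in> F" "initial_segment X (length \<sigma>) = \<sigma>"
      by (auto simp: mem_cylinder_iff)
    then have "initial_segment X s \<in> ?E"
      using assms[of \<sigma>] by (auto intro!: exI[of _ "length \<sigma>"] simp: min_absorb1)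
    then show "X \<in> cylinders ?E" by (auto simp: mem_cylinder_iff intro!: bexI)
  next
    fix X assume "X \<in> cylinders ?E"
    then obtain \<tau> k where \<tau>: "X \<in> cylinder \<tau>" "length \<tau> = s" "k \<le> s" "take k \<tau> \<in> F" by auto
    then have "X \<in> cylinder (take k \<tau>)" by (auto simp: cylinder_eq)
    with \<tau> show "X \<in> cylinders F" by blast
  qed
  also have "measure coin_measure \<dots> = (\<Sum>\<tau>\<in>?E. measure coin_measure (cylinder \<tau>))"
  proof (rule coin.finite_measure_finite_Union[OF fin])
    show "disjoint_family_on cylinder ?E"
      by (auto simp: disjoint_family_on_def mem_cylinder_iff)
  qed (auto intro: cylinder_measurable)
  also have "\<dots> = (\<Sum>\<tau>\<in>?E. (1/2) ^ s)" by (rule sum.cong) (auto simp: measure_cylinder)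
  finally show ?thesis by (simp add: power_one_over)
qed

text \<open>Strings of length \<open>s\<close> have codes below \<open>2 ^ Suc s\<close>; the
  bounded sum makes the count computable.\<close>

lemma card_strings_of_length:
  "card {\<tau>. length \<tau> = s \<and> Q \<tau>} = (\<Sum>x<2 ^ Suc s. of_bool (length (unstr x) = s \<and> Q (unstr x)))"
proof -
  have "str ` {\<tau>. length \<tau> = s \<and> Q \<tau>} = {..<2 ^ Suc s} \<inter> {x. length (unstr x) = s \<and> Q (unstr x)}"
  proof (intro set_eqI iffI)
    fix x assume "x \<in> {..<2 ^ Suc s} \<inter> {x. length (unstr x) = s \<and> Q (unstr x)}"
    then show "x \<in> str ` {\<tau>. length \<tau> = s \<and> Q \<tau>}" by (auto intro!: image_eqI[of x str "unstr x"])
  qed (use str_less in auto)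
  then have "card ({..<2 ^ Suc s} \<inter> {x. length (unstr x) = s \<and> Q (unstr x)}) =
      card {\<tau>. length \<tau> = s \<and> Q \<tau>}"
    using card_image[OF inj_on_subset[OF bij_is_inj[OF bij_str] subset_UNIV],
        of "{\<tau>. length \<tau> = s \<and> Q \<tau>}"] by simp
  then show ?thesis by simp
qed

section \<open>A nonempty effectively closed class of random reals\<close>

theorem exists_pi01_class_ml_random:
  obtains P where "P \<in> pi01_classes_within {X. ml_random X}" "P \<noteq> {}"
proof -
  obtain H where H: "decidable (\<lambda>p. H (pr1 p) (pr1 (pr2 p)) (pr1 (pr2 (pr2 p))) (pr2 (pr2 (pr2 p))))"
    and H_iff: "\<And>p n x. (\<exists>y. evals no_oracle p [n, x] y) \<longleftrightarrow> (\<exists>t. H (code p) n x t)"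
    by (rule halting_semidecidable) blast
  \<comment> \<open>\<open>G c s\<close> is the part of level \<open>c + 2\<close> of the test with program code \<open>c\<close> that is enumerated by
    stage \<open>s\<close>. A stage is used only if it is small enough, so program codes that do not
    belong to tests do no harm and the removed set has measure at most \<open>1/4 + 1/8 + \<dots> = 1/2\<close>.\<close>
  define G where "G c s = {\<sigma>. str \<sigma> < s \<and> (\<exists>t<s. H c (c + 2) (str \<sigma>) t)}" for c s
  define ok where "ok c s \<longleftrightarrow>
    (\<Sum>x<2 ^ Suc s. of_bool (length (unstr x) = s \<and> (\<exists>k<Suc s. take k (unstr x) \<in> G c s))) * 2 ^ (c + 2)
      \<le> (2 ^ s :: nat)" for c s
  \<comment> \<open>\<open>m\<close> codes the pair of program code and stage.\<close>
  define P where "P = {X. \<forall>m n. \<not> (ok (pr1 m) (pr2 m) \<and> initial_segment X n \<in> G (pr1 m) (pr2 m))}"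
  have G_mono: "G c s \<subseteq> G c s'" if "s \<le> s'" for c s s'
    unfolding G_def using that by (auto intro: less_le_trans)
  \<comment> \<open>\<open>ok\<close> is this measure bound with denominators cleared, a decidable
    comparison of natural numbers.\<close>
  have ok_iff: "ok c s \<longleftrightarrow> measure coin_measure (cylinders (G c s)) \<le> (1/2) ^ (c + 2)" for c s
  proof -
    let ?N = "card {\<tau>. length \<tau> = s \<and> (\<exists>k\<le>s. take k \<tau> \<in> G c s)}"
    have "length \<sigma> \<le> s" if "\<sigma> \<in> G c s" for \<sigma>
      using that length_le_str[of \<sigma>] by (simp add: G_def)
    then have "measure coin_measure (cylinders (G c s)) = ?N / 2 ^ s"
      by (rule measure_cylinders_count)
    moreover have "ok c s \<longleftrightarrow> ?N * 2 ^ (c + 2) \<le> 2 ^ s"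
      unfolding ok_def card_strings_of_length less_Suc_eq_le ..
    moreover have "?N * 2 ^ (c + 2) \<le> 2 ^ s \<longleftrightarrow> real ?N * 2 ^ (c + 2) \<le> 2 ^ s"
      by (simp only: of_nat_le_iff[symmetric, where ?'a = real] of_nat_mult of_nat_power of_nat_numeral)
    ultimately show ?thesis by (simp only: power_one_over) (simp add: field_simps)
  qed
  have "pi01_class P"
    unfolding P_def
  proof (rule pi01_classI)
    have G_dec: "decidable (\<lambda>p. unstr (f p) \<in> G (g p) (h p))"
      if "computable f" "computable g" "computable h" for f g h
    proof -
      have "decidable (\<lambda>z. H (g (pr1 z)) (g (pr1 z) + 2) (f (pr1 z)) (pr2 z))"
      proof -
        have "computable (\<lambda>z. prod_encode (g (pr1 z),
            prod_encode (g (pr1 z) + 2, prod_encode (f (pr1 z), pr2 z))))"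
          by (intro computable_intros computable_comp[OF that(1)] computable_comp[OF that(2)])
        from decidable_comp[OF H this] show ?thesis
          by (simp only: prod_encode_inverse fst_conv snd_conv)
      qed
      then show ?thesis
        unfolding G_def mem_Collect_eq str_unstr by (intro computable_intros that)
    qed
    have G_dec': "decidable (\<lambda>p. unstr (str (take (k p) (unstr (f p)))) \<in> G (g p) (h p))"
      if "computable f" "computable g" "computable h" "computable k" for f g h k
      by (intro G_dec computable_intros that)
    show "decidable (\<lambda>p. \<not> (ok (pr1 (pr1 p)) (pr2 (pr1 p)) \<and> unstr (pr2 p) \<in> G (pr1 (pr1 p)) (pr2 (pr1 p))))"
      unfolding ok_def
      by (intro computable_intros G_dec G_dec'[unfolded unstr_str])
  qed
  moreover have "P \<subseteq> {X. ml_random X}"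
  proof (rule subsetI, rule CollectI)
    fix X assume X: "X \<in> P"
    show "ml_random X"
      unfolding ml_random_def
    proof (intro allI impI)
      fix V assume V: "ml_test V"
      then obtain p where p: "\<And>n \<sigma>. \<sigma> \<in> V n \<longleftrightarrow> (\<exists>y. evals no_oracle p [n, str \<sigma>] y)"
        unfolding ml_test_def uniformly_ce_def by blast
      let ?c = "code p"
      have V_iff: "\<sigma> \<in> V (?c + 2) \<longleftrightarrow> (\<exists>t. H ?c (?c + 2) (str \<sigma>) t)" for \<sigma>
        unfolding p H_iff ..
      \<comment> \<open>For the program of a genuine test the measure bound passes to every finite
        part, so no stage is skipped.\<close>
      have ok: "ok ?c s" for s
      proof -
        have "G ?c s \<subseteq> V (?c + 2)" unfolding G_def using V_iff by blast
        then have "cylinders (G ?c s) \<subseteq> cylinders (V (?c + 2))" by (rule UN_mono) simp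
        then have "measure coin_measure (cylinders (G ?c s)) \<le> measure coin_measure (cylinders (V (?c + 2)))"
          by (intro coin.finite_measure_mono cylinders_measurable)
        also have "\<dots> \<le> (1/2) ^ (?c + 2)" using V unfolding ml_test_def by blast
        finally show ?thesis unfolding ok_iff .
      qed
      have "X \<notin> cylinders (V (?c + 2))"
      proof
        assume "X \<in> cylinders (V (?c + 2))"
        then obtain \<sigma> where \<sigma>: "\<sigma> \<in> V (?c + 2)" "initial_segment X (length \<sigma>) = \<sigma>"
          by (auto simp: mem_cylinder_iff)
        then obtain t where "H ?c (?c + 2) (str \<sigma>) t" unfolding V_iff by blast
        \<comment> \<open>This stage exceeds both the code of \<open>\<sigma>\<close> and the time
          \<open>t\<close>.\<close>
        then have "\<sigma> \<in> G ?c (Suc (max t (str \<sigma>)))"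
          by (auto simp: G_def intro!: exI[of _ t])
        moreover have "\<not> (ok ?c s \<and> initial_segment X n \<in> G ?c s)" for s n
          using X unfolding P_def by (auto dest: spec[of _ "prod_encode (?c, s)"])
        ultimately show False using ok \<sigma>(2) by metis
      qed
      then show "X \<notin> (\<Inter>n. cylinders (V n))" by blast
    qed
  qed
  moreover have "P \<noteq> {}"
  proof
    assume "P = {}"
    define A where "A c s = (\<Union>s'\<in>{s'. s' \<le> s \<and> ok c s'}. cylinders (G c s'))" for c s
    have A_sets: "A c s \<in> sets coin_measure" for c s
      unfolding A_def by (rule sets.finite_UN) (simp, rule cylinders_measurable)
    have A_le: "measure coin_measure (A c s) \<le> (1/2) ^ (c + 2)" for c s
    proof (cases "{s'. s' \<le> s \<and> ok c s'} = {}")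
      case False
      \<comment> \<open>The stages increase, so the largest accepted one contains all the
        others.\<close>
      define m where "m = Max {s'. s' \<le> s \<and> ok c s'}"
      have fin: "finite {s'. s' \<le> s \<and> ok c s'}" by simp
      have "ok c m" using Max_in[OF fin False] by (simp add: m_def)
      have "A c s \<subseteq> cylinders (G c m)"
        unfolding A_def
      proof (rule UN_least)
        fix s' assume "s' \<in> {s'. s' \<le> s \<and> ok c s'}"
        then have "s' \<le> m" unfolding m_def using fin by (rule Max_ge[rotated])
        from G_mono[OF this] show "cylinders (G c s') \<subseteq> cylinders (G c m)" by blast
      qed
      then have "measure coin_measure (A c s) \<le> measure coin_measure (cylinders (G c m))"
        by (intro coin.finite_measure_mono cylinders_measurable)
      with \<open>ok c m\<close> show ?thesis unfolding ok_iff by linarith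
    next
      case True
      then have "A c s = {}" unfolding A_def by (simp only: UN_empty)
      then show ?thesis by simp
    qed
    have "incseq (A c)" for c
      unfolding incseq_def A_def by (intro allI impI UN_mono) (auto intro: order_trans)
    then have lim: "(\<lambda>s. measure coin_measure (A c s)) \<longlonglongrightarrow> measure coin_measure (\<Union>s. A c s)" for c
      using A_sets by (intro coin.finite_Lim_measure_incseq) auto
    have UA_le: "measure coin_measure (\<Union>s. A c s) \<le> (1/2) ^ (c + 2)" for c
      by (rule LIMSEQ_le_const2[OF lim]) (use A_le in blast)
    have sums: "(\<lambda>c. (1/2) ^ (c + 2) :: real) sums (1/2)"
      using sums_mult[OF geometric_sums[of "1/2 :: real"], of "1/4"] by (simp add: power_add)
    have "summable (\<lambda>c. measure coin_measure (\<Union>s. A c s))"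
      by (rule summable_comparison_test'[OF sums_summable[OF sums], where N = 0])
        (use UA_le in simp)
    moreover from this have "(\<Sum>c. measure coin_measure (\<Union>s. A c s)) \<le> 1/2"
      using suminf_le[OF UA_le _ sums_summable[OF sums]] sums_unique[OF sums] by simp
    moreover have "range (\<lambda>c. \<Union>s. A c s) \<subseteq> sets coin_measure"
      using A_sets by auto
    ultimately have "measure coin_measure (\<Union>c. \<Union>s. A c s) \<le> 1/2"
      using coin.finite_measure_subadditive_countably[of "\<lambda>c. \<Union>s. A c s"] by linarith
    \<comment> \<open>If \<open>P\<close> were empty, every real would be removed, and a set of
      measure at most \<open>1/2\<close> would be the whole space.\<close>
    moreover have "(\<Union>c. \<Union>s. A c s) = UNIV"
    proof (intro set_eqI iffI UNIV_I)
      fix X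
      from \<open>P = {}\<close> obtain m n where m: "ok (pr1 m) (pr2 m)" "initial_segment X n \<in> G (pr1 m) (pr2 m)"
        unfolding P_def by blast
      then have "X \<in> A (pr1 m) (pr2 m)"
        unfolding A_def by (auto simp: mem_cylinder_iff intro!: exI[of _ "pr2 m"] bexI[OF _ m(2)])
      then show "X \<in> (\<Union>c. \<Union>s. A c s)" by blast
    qed
    ultimately show False using coin.prob_space by simp
  qed
  ultimately show thesis by (intro that[of P]) (simp_all add: pi01_classes_within_def)
qed

section \<open>The families of classes\<close>

lemma pi01_class_constant: "pi01_class {\<lambda>_. b}"
proof -
  have "decidable (\<lambda>p. \<forall>i<length (unstr (pr2 p)). bit_at (unstr (pr2 p)) i \<longleftrightarrow> b)"
    by (intro computable_intros)
  from pi01_classI[OF this]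
  have "pi01_class {X. \<forall>(m::nat) n. \<forall>i<length (initial_segment X n). bit_at (initial_segment X n) i \<longleftrightarrow> b}" .
  also have "{X. \<forall>(m::nat) n. \<forall>i<length (initial_segment X n). bit_at (initial_segment X n) i \<longleftrightarrow> b} = {\<lambda>_. b}"
    by (auto simp: bit_at_def)
  finally show ?thesis .
qed

text \<open>Bit \<open>n\<close> of \<open>X\<close> is the answer to the query
  \<open>Suc n\<close>. This keeps the non-computable reals and the Muchnik cones closed under
  prepending.\<close>

lemma turing_le_case_nat: "turing_le X (case_nat a X)"
  unfolding turing_le_def
proof (intro exI allI)
  fix n
  show "evals (case_nat a X) (Comp Oracle [Succ]) [n] (of_bool (X n))"
    using evals_Oracle[of "case_nat a X" "Suc n"]
    by (intro evals_Comp[where ys = "[Suc n]"]) (auto intro: evals_Succ)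
qed

lemma computable_real_mono: "turing_le X Y \<Longrightarrow> computable_real Y \<Longrightarrow> computable_real X"
  unfolding computable_real_iff by (rule turing_le_trans)

lemma finite_case_nat:
  assumes "finite {n. X n = b}" shows "finite {n. case_nat a X n = b}"
proof -
  have "{n. case_nat a X n = b} \<subseteq> insert 0 (Suc ` {n. X n = b})"
  proof
    fix n assume "n \<in> {n. case_nat a X n = b}"
    then show "n \<in> insert 0 (Suc ` {n. X n = b})" by (cases n) auto
  qed
  then show ?thesis using assms by (meson finite_imageI finite_insert finite_subset)
qed

text \<open>\<open>b = True\<close> is the case of finite sets and \<open>b = False\<close> that of
  cofinite sets; the constant real \<open>\<not> b\<close> gives the nonempty class.\<close>

lemma no_effective_numbering_finite: "\<not> has_effective_numbering (pi01_classes_within {X. finite {n. X n = b}})"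
proof (rule no_effective_numbering[where b = b])
  show "{\<lambda>_. \<not> b} \<in> pi01_classes_within {X. finite {n. X n = b}}"
    by (simp add: pi01_classes_within_def pi01_class_constant)
  show "X \<notin> {X. finite {n. X n = b}}" if "\<forall>n\<ge>N. X n = b" for X and N :: nat
  proof -
    have "{N..} \<subseteq> {n. X n = b}" using that by auto
    from finite_subset[OF this] infinite_Ici[of N] show ?thesis by auto
  qed
qed (auto intro: finite_case_nat)

text \<open>The Muchnik clause asks for a nonempty class: otherwise the family is
  \<open>{{}}\<close>, which has an effective numbering.\<close>

theorem corollary18:
  shows "\<not> has_effective_numbering (pi01_classes_within {X. ml_random X}) \<and>
    \<not> has_effective_numbering (pi01_classes_within {X. \<not> computable_real X}) \<and>
    (\<forall>d \<in> muchnik_degrees. d \<noteq> zero_degree \<longrightarrow>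
       (\<exists>P \<in> pi01_classes_within {X. degree_le d (muchnik_degree {X})}. P \<noteq> {}) \<longrightarrow>
       \<not> has_effective_numbering (pi01_classes_within {X. degree_le d (muchnik_degree {X})})) \<and>
    \<not> has_effective_numbering (pi01_classes_within {X. finite {n. X n}}) \<and>
    \<not> has_effective_numbering (pi01_classes_within {X. finite {n. \<not> X n}})"
proof (intro conjI ballI impI)
  obtain P where P: "P \<in> pi01_classes_within {X. ml_random X}" "P \<noteq> {}"
    by (rule exists_pi01_class_ml_random)
  from P show "\<not> has_effective_numbering (pi01_classes_within {X. ml_random X})"
  proof (rule no_effective_numbering[where b = False, rotated 2])
    show "X \<notin> {X. ml_random X}" if "\<forall>n\<ge>N. X n = False" for X N
      using eventually_constant_computable[OF that] computable_not_ml_random by blast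
  qed (auto intro: ml_random_case_nat)
  \<comment> \<open>Random reals are not computable, so the same class serves as a starting point
    here.\<close>
  have "P \<in> pi01_classes_within {X. \<not> computable_real X}"
    using P(1) computable_not_ml_random by (auto simp: pi01_classes_within_def)
  then show "\<not> has_effective_numbering (pi01_classes_within {X. \<not> computable_real X})"
    using P(2)
  proof (rule no_effective_numbering[where b = False, rotated 2])
    show "X \<notin> {X. \<not> computable_real X}" if "\<forall>n\<ge>N. X n = False" for X N
      using eventually_constant_computable[OF that] by blast
  qed (auto dest: computable_real_mono[OF turing_le_case_nat])
next
  fix d
  assume "d \<in> muchnik_degrees" "d \<noteq> zero_degree"
    and "\<exists>P \<in> pi01_classes_within {X. degree_le d (muchnik_degree {X})}. P \<noteq> {}"
  then obtain P where P: "P \<in> pi01_classes_within {X. degree_le d (muchnik_degree {X})}" "P \<noteq> {}"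
    by blast
  from \<open>d \<in> muchnik_degrees\<close> obtain A where d: "d = muchnik_degree A"
    unfolding muchnik_degrees_def muchnik_degree_def by (rule quotientE)
  have above: "degree_le d (muchnik_degree {X}) \<longleftrightarrow> (\<exists>Y\<in>A. turing_le Y X)" for X
    unfolding d degree_le_muchnik_degree by (simp add: muchnik_le_def)
  \<comment> \<open>A computable member of \<open>A\<close> is reducible to every real, which would
    make \<open>A\<close> equivalent to \<open>UNIV\<close> and \<open>d\<close> the zero
    degree.\<close>
  have noncomputable: "\<not> computable_real Y" if "Y \<in> A" for Y
  proof
    assume "computable_real Y"
    with that have "muchnik_le A UNIV" "muchnik_le UNIV A"
      unfolding muchnik_le_def using computable_turing_le turing_le_refl by blast+
    then have "d = zero_degree"
      unfolding d zero_degree_eq muchnik_degree_def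
      by (intro equiv_class_eq[OF equiv_muchnik]) (simp add: muchnik_equiv_def)
    with \<open>d \<noteq> zero_degree\<close> show False ..
  qed
  from P show "\<not> has_effective_numbering (pi01_classes_within {X. degree_le d (muchnik_degree {X})})"
  proof (rule no_effective_numbering[where b = False, rotated 2])
    show "case_nat a X \<in> {X. degree_le d (muchnik_degree {X})}"
      if "X \<in> {X. degree_le d (muchnik_degree {X})}" for X a
      using that turing_le_case_nat turing_le_trans unfolding above by blast
    \<comment> \<open>Such an \<open>X\<close> is computable, and so is everything it computes,
      whereas \<open>A\<close> has no computable member.\<close>
    show "X \<notin> {X. degree_le d (muchnik_degree {X})}" if "\<forall>n\<ge>N. X n = False" for X N
      using eventually_constant_computable[OF that] noncomputable computable_real_mono
      unfolding above by blast
  qed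
next
  show "\<not> has_effective_numbering (pi01_classes_within {X. finite {n. X n}})"
    using no_effective_numbering_finite[of True] by simp
  show "\<not> has_effective_numbering (pi01_classes_within {X. finite {n. \<not> X n}})"
    using no_effective_numbering_finite[of False] by simp
qed

end
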